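(* Consider Wyner's symmetric linear network with mixed-delay traffic (defined in the context) with $\mathsf L\ge 1$ antennas at every terminal, cooperation prelogs $\mu_{\mathrm{Tx}},\mu_{\mathrm{Rx}}\ge 0$, and even maximum delay $D\ge 0$. Every MG pair $(S^{(F)},S^{(S)})$ in the optimal MG region $\mathcal S^\star(\mu_{\mathrm{Tx}},\mu_{\mathrm{Rx}},D)$ satisfies $$S^{(F)}\le\frac{\mathsf L}{2},\qquad S^{(F)}+S^{(S)}\le\mathsf L\cdot\frac{D+1}{D+2}.$$
   Context: Network. There are $K$ Tx/Rx pairs ($K$ even) indexed by $[K]=\{1,\dots,K\}$; each Tx and Rx has $\mathsf L$ antennas. At time $t\in\{1,\dots,n\}$ Rx $k$ observes the real vector $$\mathbf Y_{k,t}=\mathsf H_{k,k}\mathbf X_{k,t}+\mathsf H_{k-1,k}\mathbf X_{k-1,t}+\mathsf H_{k+1,k}\mathbf X_{k+1,t}+\mathbf Z_{k,t}\in\mathbb R^{\mathsf L},$$ where $\mathbf X_{k,t}\in\mathbb R^{\mathsf L}$ is the input of Tx $k$ ($\mathbf X_{0,t}=\mathbf X_{K+1,t}=0$), the $\mathsf H_{\hat k,k}$ are fixed full-rank $\mathsf L\times\mathsf L$ matrices, and the noise is i.i.d. standard Gaussian. The neighbour sets are $\mathcal N_{\mathrm{Tx}}(k)=\mathcal N_{\mathrm{Rx}}(k)=\{k-1,k+1\}\cap[K]$. Messages. Tx $k$ has independent messages for Rx $k$: a "fast" message $M_k^{(F)}$ uniform on $\{1,\dots,\lfloor 2^{nR_k^{(F)}}\rfloor\}$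 and a "slow" message $M_k^{(S)}$ uniform on $\{1,\dots,\lfloor 2^{nR_k^{(S)}}\rfloor\}$; all messages are independent of each other and of the noise. Cooperation and coding. One chooses nonnegative integers $D_{\mathrm{Tx}},D_{\mathrm{Rx}}$ with $D_{\mathrm{Tx}}+D_{\mathrm{Rx}}\le D$. In Tx-round $j\in\{1,\dots,D_{\mathrm{Tx}}\}$, Tx $k$ sends to each $\ell\in\mathcal N_{\mathrm{Tx}}(k)$ a message $T^{(j)}_{k\to\ell}$ that is a function of $M_k^{(S)}$ and of $\{T^{(1)}_{\ell'\to k},\dots,T^{(j-1)}_{\ell'\to k}\}_{\ell'\in\mathcal N_{\mathrm{Tx}}(k)}$, subject to $\sum_{j=1}^{D_{\mathrm{Tx}}}H(T^{(j)}_{k\to\ell})\le\mu_{\mathrm{Tx}}\frac n2\log\mathsf P$. Then $\mathbf X_k^n$ is a function of $M_k^{(F)},M_k^{(S)}$ and all Tx-cooperation messages received by Tx $k$, with $\frac1n\sum_{t=1}^n\|\mathbf X_{k,t}\|^2\le\mathsf P$ almost surely. Rx $k$ first decodes $\hat M_k^{(F)}$ as a function of $\mathbf Y_k^n$ only. Then in Rx-round $j\in\{1,\dots,D_{\mathrm{Rx}}\}$, Rx $k$ sends to each $\ell\in\mathcal N_{\mathrm{Rx}}(k)$ a message $Q^{(j)}_{k\to\ell}$ that is a function of $\mathbf Y_k^n$ and of $\{Q^{(1)}_{\ell'\to k},\dots,Q^{(j-1)}_{\ell'\to k}\}_{\ell'\in\mathcal N_{\mathrm{Rx}}(k)}$,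 subject to $\sum_{j=1}^{D_{\mathrm{Rx}}}H(Q^{(j)}_{k\to\ell})\le\mu_{\mathrm{Rx}}\frac n2\log\mathsf P$. Finally Rx $k$ decodes $\hat M_k^{(S)}$ as a function of $\mathbf Y_k^n$ and all Rx-cooperation messages it received. MG region. For given $K,\mathsf P,D,\mu_{\mathrm{Tx}},\mu_{\mathrm{Rx}}$, average rates $(\bar R_K^{(F)},\bar R_K^{(S)})$ are achievable if there are rates with $\bar R_K^{(F)}=\frac1K\sum_kR_k^{(F)}$, $\bar R_K^{(S)}=\frac1K\sum_kR_k^{(S)}$, nonnegative integers $D_{\mathrm{Tx}},D_{\mathrm{Rx}}$ with $D_{\mathrm{Tx}}+D_{\mathrm{Rx}}\le D$, Tx-cooperation functions producing the $T^{(j)}_{k\to\ell}$ with $\sum_{j=1}^{D_{\mathrm{Tx}}}H(T^{(j)}_{k\to\ell})\le\mu_{\mathrm{Tx}}\frac n2\log\mathsf P$, encoding functions producing the $\mathbf X_k^n$ with $\frac1n\sum_{t=1}^n\|\mathbf X_{k,t}\|^2\le\mathsf P$ almost surely, Rx-cooperation functions producing the $Q^{(j)}_{k\to\ell}$ with $\sum_{j=1}^{D_{\mathrm{Rx}}}H(Q^{(j)}_{k\to\ell})\le\mu_{\mathrm{Rx}}\frac n2\log\mathsf P$, and decoding functions producing $\hat M_k^{(F)}$ from $\mathbf Y_k^n$ and $\hat M_k^{(S)}$ from $\mathbf Y_k^n$ and the Rx-cooperation messages received by Rx $k$, such that the probability that some fast or slow message is decoded incorrectly tends to $0$ as $n\to\infty$.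 A pair $(S^{(F)},S^{(S)})$ of multiplexing gains (MG) is achievable if for every $K$ and $\mathsf P>0$ there are achievable average rates $\bar R_K^{(F)}(\mathsf P),\bar R_K^{(S)}(\mathsf P)$ with $$S^{(F)}=\limsup_{K\to\infty}\limsup_{\mathsf P\to\infty}\frac{\bar R_K^{(F)}(\mathsf P)}{\frac12\log\mathsf P},\qquad S^{(S)}=\limsup_{K\to\infty}\limsup_{\mathsf P\to\infty}\frac{\bar R_K^{(S)}(\mathsf P)}{\frac12\log\mathsf P}.$$ The optimal MG region $\mathcal S^\star(\mu_{\mathrm{Tx}},\mu_{\mathrm{Rx}},D)$ is the closure of the set of achievable MG pairs.
   Formalization: The two limsups defining an MG pair are additionally required to be attained along a common sequence (in P for each K, and in K); with independent limsups, rates alternating between an all-fast and an all-slow operating point would violate the sum bound. *)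

theory Defs
  imports "HOL-Probability.Probability"
begin

text \<open>
  Terminals are numbered from 1 to K, time slots from 1 to n; the type \<^typ>\<open>'l\<close> indexes the
  antennas of a terminal. All logarithms are to base 2. Cooperation messages are encoded as
  natural numbers: a message of finite entropy takes countably many values almost surely.
\<close>

definition neighbours :: "nat \<Rightarrow> nat \<Rightarrow> nat set" where
  "neighbours K k = {k - 1, k + 1} \<inter> {1..K}"

text \<open>A transcript \<open>T\<close> maps a round \<open>j\<close>, a sender \<open>k\<close> and an addressee \<open>l\<close> to the message sent.\<close>

type_synonym transcript = "nat \<Rightarrow> nat \<Rightarrow> nat \<Rightarrow> nat"

type_synonym received_msgs = "nat \<Rightarrow> nat \<Rightarrow> nat"

definition received :: "nat \<Rightarrow> nat \<Rightarrow> transcript \<Rightarrow> nat \<Rightarrow> received_msgs" where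
  "received K j T k = (\<lambda>i\<in>{1..j}. \<lambda>l\<in>neighbours K k. T i l k)"

text \<open>
  \<open>exchange K \<phi> obs j\<close> is the transcript of the first \<open>j\<close> rounds when terminal \<open>k\<close> observes \<open>obs k\<close>
  and sends in round \<open>i\<close> to \<open>l\<close> the value of \<open>\<phi> i k l\<close> at its observation and the messages it
  received in rounds \<open>1, \<dots>, i - 1\<close>.
\<close>

primrec exchange ::
  "nat \<Rightarrow> (nat \<Rightarrow> nat \<Rightarrow> nat \<Rightarrow> 'o \<Rightarrow> received_msgs \<Rightarrow> nat) \<Rightarrow> (nat \<Rightarrow> 'o) \<Rightarrow> nat \<Rightarrow> transcript" where
  "exchange K \<phi> obs 0 = (\<lambda>_ _ _. 0)"
| "exchange K \<phi> obs (Suc j) =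
     (exchange K \<phi> obs j)
       (Suc j := (\<lambda>k l. \<phi> (Suc j) k l (obs k) (received K j (exchange K \<phi> obs j) k)))"

text \<open>
  The encoder of user \<open>k\<close> maps its fast message, its slow message and the received cooperation
  messages to the input block \<open>t \<mapsto> X\<^sub>k\<^sub>,\<^sub>t\<close>.
\<close>

record ('l::finite) coding_scheme =
  tx_msg :: "nat \<Rightarrow> nat \<Rightarrow> nat \<Rightarrow> nat \<Rightarrow> received_msgs \<Rightarrow> nat"
  encoder :: "nat \<Rightarrow> nat \<Rightarrow> nat \<Rightarrow> received_msgs \<Rightarrow> nat \<Rightarrow> real ^ 'l"
  rx_msg :: "nat \<Rightarrow> nat \<Rightarrow> nat \<Rightarrow> (nat \<Rightarrow> real ^ 'l) \<Rightarrow> received_msgs \<Rightarrow> nat"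
  fast_decoder :: "nat \<Rightarrow> (nat \<Rightarrow> real ^ 'l) \<Rightarrow> nat"
  slow_decoder :: "nat \<Rightarrow> (nat \<Rightarrow> real ^ 'l) \<Rightarrow> received_msgs \<Rightarrow> nat"

text \<open>A sample consists of the fast messages, the slow messages and the noise.\<close>

type_synonym 'l sample = "(nat \<Rightarrow> nat) \<times> (nat \<Rightarrow> nat) \<times> (nat \<times> nat \<times> 'l \<Rightarrow> real)"

definition message_set :: "nat \<Rightarrow> real \<Rightarrow> nat set" where
  "message_set n R = {1..nat \<lfloor>2 powr (real n * R)\<rfloor>}"

definition std_gaussian :: "real measure" where
  "std_gaussian = density lborel (\<lambda>x. ennreal (std_normal_density x))"

definition sample_space ::
  "nat \<Rightarrow> nat \<Rightarrow> (nat \<Rightarrow> real) \<Rightarrow> (nat \<Rightarrow> real) \<Rightarrow> ('l::finite) sample measure" where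
  "sample_space K n RF RS =
     (\<Pi>\<^sub>M k\<in>{1..K}. uniform_count_measure (message_set n (RF k))) \<Otimes>\<^sub>M
     (\<Pi>\<^sub>M k\<in>{1..K}. uniform_count_measure (message_set n (RS k))) \<Otimes>\<^sub>M
     (\<Pi>\<^sub>M i\<in>{1..K} \<times> {1..n} \<times> (UNIV :: 'l set). std_gaussian)"

definition fast_message :: "'l sample \<Rightarrow> nat \<Rightarrow> nat" where
  "fast_message \<omega> = fst \<omega>"

definition slow_message :: "'l sample \<Rightarrow> nat \<Rightarrow> nat" where
  "slow_message \<omega> = fst (snd \<omega>)"

definition noise :: "('l::finite) sample \<Rightarrow> nat \<Rightarrow> nat \<Rightarrow> real ^ 'l" where
  "noise \<omega> k t = (\<chi> i. snd (snd \<omega>) (k, t, i))"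

definition tx_transcript ::
  "nat \<Rightarrow> nat \<Rightarrow> ('l::finite) coding_scheme \<Rightarrow> 'l sample \<Rightarrow> transcript" where
  "tx_transcript K DT C \<omega> = exchange K (tx_msg C) (slow_message \<omega>) DT"

definition channel_input ::
  "nat \<Rightarrow> nat \<Rightarrow> ('l::finite) coding_scheme \<Rightarrow> 'l sample \<Rightarrow> nat \<Rightarrow> nat \<Rightarrow> real ^ 'l" where
  "channel_input K DT C \<omega> k t =
     (if k \<in> {1..K}
      then encoder C k (fast_message \<omega> k) (slow_message \<omega> k)
             (received K DT (tx_transcript K DT C \<omega>) k) t
      else 0)"

text \<open>\<open>H k' k\<close> is the channel matrix from transmitter \<open>k'\<close> to receiver \<open>k\<close>.\<close>

definition output_block ::
  "(nat \<Rightarrow> nat \<Rightarrow> real ^ 'l ^ 'l) \<Rightarrow> nat \<Rightarrow> nat \<Rightarrow> nat \<Rightarrow> ('l::finite) coding_scheme \<Rightarrow> 'l sample \<Rightarrow>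
   nat \<Rightarrow> nat \<Rightarrow> real ^ 'l" where
  "output_block H K n DT C \<omega> k =
     (\<lambda>t\<in>{1..n}. H k k *v channel_input K DT C \<omega> k t
              + H (k - 1) k *v channel_input K DT C \<omega> (k - 1) t
              + H (k + 1) k *v channel_input K DT C \<omega> (k + 1) t
              + noise \<omega> k t)"

definition rx_transcript ::
  "(nat \<Rightarrow> nat \<Rightarrow> real ^ 'l ^ 'l) \<Rightarrow> nat \<Rightarrow> nat \<Rightarrow> nat \<Rightarrow> nat \<Rightarrow> ('l::finite) coding_scheme \<Rightarrow>
   'l sample \<Rightarrow> transcript" where
  "rx_transcript H K n DT DR C \<omega> = exchange K (rx_msg C) (output_block H K n DT C \<omega>) DR"

definition decoded_fast ::
  "(nat \<Rightarrow> nat \<Rightarrow> real ^ 'l ^ 'l) \<Rightarrow> nat \<Rightarrow> nat \<Rightarrow> nat \<Rightarrow> ('l::finite) coding_scheme \<Rightarrow>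
   'l sample \<Rightarrow> nat \<Rightarrow> nat" where
  "decoded_fast H K n DT C \<omega> k = fast_decoder C k (output_block H K n DT C \<omega> k)"

definition decoded_slow ::
  "(nat \<Rightarrow> nat \<Rightarrow> real ^ 'l ^ 'l) \<Rightarrow> nat \<Rightarrow> nat \<Rightarrow> nat \<Rightarrow> nat \<Rightarrow> ('l::finite) coding_scheme \<Rightarrow>
   'l sample \<Rightarrow> nat \<Rightarrow> nat" where
  "decoded_slow H K n DT DR C \<omega> k =
     slow_decoder C k (output_block H K n DT C \<omega> k)
       (received K DR (rx_transcript H K n DT DR C \<omega>) k)"

text \<open>
  Shannon entropy in bits. The library constant \<^const>\<open>prob_space.entropy\<close> is a Bochner integral
  and therefore 0 for a variable of infinite entropy; here the value is \<open>\<infinity>\<close> in that case.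
\<close>

definition shannon_entropy :: "'a measure \<Rightarrow> ('a \<Rightarrow> nat) \<Rightarrow> ereal" where
  "shannon_entropy M X =
     enn2ereal (\<Sum>x. ennreal (- measure M {\<omega> \<in> space M. X \<omega> = x}
                              * log 2 (measure M {\<omega> \<in> space M. X \<omega> = x})))"

text \<open>
  The budget \<open>\<mu> n/2 log P\<close> is negative for \<open>P < 1\<close>. It constrains a phase only if there is at least
  one cooperation round; otherwise the empty sum 0 would violate it, and no rates at all would be
  achievable for \<open>P < 1\<close>.
\<close>

definition cooperation_budget_ok ::
  "'a measure \<Rightarrow> nat \<Rightarrow> nat \<Rightarrow> real \<Rightarrow> nat \<Rightarrow> real \<Rightarrow> ('a \<Rightarrow> transcript) \<Rightarrow> bool" where
  "cooperation_budget_ok M K n P d \<mu> T \<longleftrightarrow>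
     (d > 0 \<longrightarrow> (\<forall>k\<in>{1..K}. \<forall>l\<in>neighbours K k.
        (\<Sum>j=1..d. shannon_entropy M (\<lambda>\<omega>. T \<omega> j k l)) \<le> ereal (\<mu> * (real n / 2) * log 2 P)))"

text \<open>
  The transmitter-side maps act on finitely many messages and need no measurability condition.
  For the maps that also take received messages, measurability for each fixed value of these is
  joint measurability, since there are only countably many values.
\<close>

definition measurable_receivers :: "nat \<Rightarrow> nat \<Rightarrow> nat \<Rightarrow> ('l::finite) coding_scheme \<Rightarrow> bool" where
  "measurable_receivers K n DR C \<longleftrightarrow>
     (let B = (\<Pi>\<^sub>M t\<in>{1..n}. (borel :: (real ^ 'l) measure)) in
       \<forall>k\<in>{1..K}.
         fast_decoder C k \<in> B \<rightarrow>\<^sub>M count_space UNIV \<and>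
         (\<forall>r. (\<lambda>y. slow_decoder C k y r) \<in> B \<rightarrow>\<^sub>M count_space UNIV) \<and>
         (\<forall>j\<in>{1..DR}. \<forall>l\<in>neighbours K k. \<forall>r.
            (\<lambda>y. rx_msg C j k l y r) \<in> B \<rightarrow>\<^sub>M count_space UNIV))"

definition admissible_scheme ::
  "(nat \<Rightarrow> nat \<Rightarrow> real ^ 'l ^ 'l) \<Rightarrow> nat \<Rightarrow> nat \<Rightarrow> real \<Rightarrow> real \<Rightarrow> real \<Rightarrow> nat \<Rightarrow> nat \<Rightarrow>
   (nat \<Rightarrow> real) \<Rightarrow> (nat \<Rightarrow> real) \<Rightarrow> ('l::finite) coding_scheme \<Rightarrow> bool" where
  "admissible_scheme H K n P \<mu>T \<mu>R DT DR RF RS C \<longleftrightarrow>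
     (let M = (sample_space K n RF RS :: 'l sample measure) in
       cooperation_budget_ok M K n P DT \<mu>T (tx_transcript K DT C) \<and>
       (\<forall>k\<in>{1..K}. AE \<omega> in M.
          (1 / real n) * (\<Sum>t=1..n. (norm (channel_input K DT C \<omega> k t))\<^sup>2) \<le> P) \<and>
       cooperation_budget_ok M K n P DR \<mu>R (rx_transcript H K n DT DR C) \<and>
       measurable_receivers K n DR C)"

definition error_prob ::
  "(nat \<Rightarrow> nat \<Rightarrow> real ^ 'l ^ 'l) \<Rightarrow> nat \<Rightarrow> nat \<Rightarrow> nat \<Rightarrow> nat \<Rightarrow>
   (nat \<Rightarrow> real) \<Rightarrow> (nat \<Rightarrow> real) \<Rightarrow> ('l::finite) coding_scheme \<Rightarrow> real" where
  "error_prob H K n DT DR RF RS C =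
     (let M = (sample_space K n RF RS :: 'l sample measure) in
       measure M {\<omega> \<in> space M. \<exists>k\<in>{1..K}.
         decoded_fast H K n DT C \<omega> k \<noteq> fast_message \<omega> k \<or>
         decoded_slow H K n DT DR C \<omega> k \<noteq> slow_message \<omega> k})"

definition average_rates_achievable ::
  "(nat \<Rightarrow> nat \<Rightarrow> real ^ ('l::finite) ^ 'l) \<Rightarrow> nat \<Rightarrow> real \<Rightarrow> real \<Rightarrow> real \<Rightarrow> nat \<Rightarrow> real \<Rightarrow> real \<Rightarrow> bool"
  where
  "average_rates_achievable H K P \<mu>T \<mu>R D rF rS \<longleftrightarrow>
     (\<exists>RF RS DT DR. \<exists>C :: nat \<Rightarrow> 'l coding_scheme.
        (\<forall>k\<in>{1..K}. 0 \<le> RF k \<and> 0 \<le> RS k) \<and>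
        rF = (1 / real K) * (\<Sum>k=1..K. RF k) \<and>
        rS = (1 / real K) * (\<Sum>k=1..K. RS k) \<and>
        DT + DR \<le> D \<and>
        (\<forall>n\<ge>1. admissible_scheme H K n P \<mu>T \<mu>R DT DR RF RS (C n)) \<and>
        (\<lambda>n. error_prob H K n DT DR RF RS (C n)) \<longlonglongrightarrow> 0)"

text \<open>
  The two upper limits that define a multiplexing-gain pair have to be attained along a common
  sequence. With unrelated upper limits, rates that alternate between two operating points as
  \<open>P \<rightarrow> \<infinity>\<close> would combine the best fast gain of one point with the best slow gain of the other.
  Setting the rates to 0 off the common sequence shows that this describes exactly the iterated
  joint limit points of the normalised rate pairs.
\<close>

definition joint_limsup ::
  "'a filter \<Rightarrow> ('a \<Rightarrow> ereal) \<Rightarrow> ('a \<Rightarrow> ereal) \<Rightarrow> ereal \<Rightarrow> ereal \<Rightarrow> bool" where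
  "joint_limsup F f g a b \<longleftrightarrow>
     a = Limsup F f \<and> b = Limsup F g \<and>
     (\<exists>s. filterlim s F sequentially \<and> (\<lambda>i. f (s i)) \<longlonglongrightarrow> a \<and> (\<lambda>i. g (s i)) \<longlonglongrightarrow> b)"

text \<open>Only even \<open>K\<close> are admitted, so the limit in \<open>K\<close> is taken over \<open>K = 2 * m\<close>.\<close>

definition achievable_mg_pairs ::
  "(nat \<Rightarrow> nat \<Rightarrow> real ^ ('l::finite) ^ 'l) \<Rightarrow> real \<Rightarrow> real \<Rightarrow> nat \<Rightarrow> (real \<times> real) set" where
  "achievable_mg_pairs H \<mu>T \<mu>R D =
     {(SF, SS). \<exists>(rF :: nat \<Rightarrow> real \<Rightarrow> real) rS (gF :: nat \<Rightarrow> ereal) gS.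
        (\<forall>K P. 0 < K \<and> even K \<and> 0 < P \<longrightarrow>
           average_rates_achievable H K P \<mu>T \<mu>R D (rF K P) (rS K P)) \<and>
        (\<forall>K. 0 < K \<and> even K \<longrightarrow>
           joint_limsup at_top
             (\<lambda>P. ereal (rF K P / (1 / 2 * log 2 P))) (\<lambda>P. ereal (rS K P / (1 / 2 * log 2 P)))
             (gF K) (gS K)) \<and>
        joint_limsup sequentially (\<lambda>m. gF (2 * m)) (\<lambda>m. gS (2 * m)) (ereal SF) (ereal SS)}"

definition optimal_mg_region ::
  "(nat \<Rightarrow> nat \<Rightarrow> real ^ ('l::finite) ^ 'l) \<Rightarrow> real \<Rightarrow> real \<Rightarrow> nat \<Rightarrow> (real \<times> real) set" where
  "optimal_mg_region H \<mu>T \<mu>R D = closure (achievable_mg_pairs H \<mu>T \<mu>R D)"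

end

theory Submission
  imports Defs
begin

text \<open>
  The converse is a packing argument that needs no entropy. For a fixed choice \<open>m\<close> of all messages the
  outputs are \<open>x m + z\<close> with Gaussian noise \<open>z\<close>, and the sets of outputs that are decoded to different
  \<open>m\<close> are disjoint. Remove two out of \<open>2 D + 4\<close> receivers. From the remaining outputs the
  messages that determine the inputs of the two middle transmitters of each block can be decoded, since
  cooperation reaches at most \<open>D\<close> users far; subtracting these inputs, the channel can be inverted step
  by step outwards, which determines all other inputs, and hence the removed outputs, up to a
  multiple of the observed noise. So only the \<open>D + 1\<close> out of \<open>D + 2\<close> observed receivers contribute a factor growing
  like \<open>P\<close> to the power \<open>n L / 2\<close> to the number of messages. The bound on the fast gain is the same
  argument with \<open>D = 0\<close>, after fixing the slow messages.
\<close>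

section \<open>Packing with Gaussian noise\<close>

text \<open>The fraction comes from counting equations. Every receiver combines three consecutive
  inputs, so inverting the channel along the line is a recursion of order two that needs two
  adjacent known inputs to start; hence two centres per block. Cooperation of total reach D around
  them involves 2 D + 2 receivers, and these equations together with the two known inputs determine
  2 D + 4 inputs, so two outputs per block are redundant. The obstacle is the noise: equal
  observations fix the remaining inputs only up to an error without a uniform bound, so candidates
  cannot simply be counted. Instead the likelihoods of successful decoding are integrated over all
  outputs, and at each output only one message contributes. The order of the limits permits crude
  constants: a factor c^n in which c depends on K, D and the channel but not on P adds a constant to
  the rate bound, and this vanishes after division by log P.\<close>

lemma nn_integral_gaussian:
  fixes s b :: real
  assumes "s > 0"
  shows "(\<integral>\<^sup>+ x. ennreal (exp (- (x - b)\<^sup>2 / s)) \<partial>lborel) = ennreal (sqrt (pi * s))"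
proof -
  define \<sigma> where "\<sigma> = sqrt (s / 2)"
  have \<sigma>: "\<sigma> > 0" "2 * \<sigma>\<^sup>2 = s" using assms by (auto simp: \<sigma>_def)
  interpret prob_space "density lborel (normal_density b \<sigma>)"
    by (rule prob_space_normal_density[OF \<sigma>(1)])
  have "(\<integral>\<^sup>+ x. ennreal (normal_density b \<sigma> x) \<partial>lborel) = 1"
    using emeasure_space_1 by (simp add: emeasure_density)
  moreover have "exp (- (x - b)\<^sup>2 / s) = sqrt (pi * s) * normal_density b \<sigma> x" for x
  proof -
    have "2 * pi * \<sigma>\<^sup>2 = pi * s" using \<sigma>(2) by auto
    then have "normal_density b \<sigma> x = 1 / sqrt (pi * s) * exp (- (x - b)\<^sup>2 / s)"
      unfolding normal_density_def \<sigma>(2) by simp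
    then show ?thesis using assms by simp
  qed
  ultimately show ?thesis
    using assms by (simp add: ennreal_mult' nn_integral_cmult)
qed

lemma nn_integral_PiM_gaussian:
  fixes s :: real
  assumes "finite I" "s > 0"
  shows "(\<integral>\<^sup>+ y. ennreal (exp (- (\<Sum>i\<in>I. (y i - b i)\<^sup>2) / s)) \<partial>(\<Pi>\<^sub>M i\<in>I. lborel))
         = ennreal (sqrt (pi * s) ^ card I)"
proof -
  interpret product_sigma_finite "\<lambda>_. lborel :: real measure" ..
  have "ennreal (exp (- (\<Sum>i\<in>I. (y i - b i)\<^sup>2) / s)) = (\<Prod>i\<in>I. ennreal (exp (- (y i - b i)\<^sup>2 / s)))"
    for y :: "'a \<Rightarrow> real"
    using assms by (simp add: prod_ennreal exp_sum[symmetric] sum_negf sum_divide_distrib)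
  then have "(\<integral>\<^sup>+ y. ennreal (exp (- (\<Sum>i\<in>I. (y i - b i)\<^sup>2) / s)) \<partial>(\<Pi>\<^sub>M i\<in>I. lborel))
     = (\<Prod>i\<in>I. \<integral>\<^sup>+ x. ennreal (exp (- (x - b i)\<^sup>2 / s)) \<partial>lborel)"
    using assms by (simp, subst product_nn_integral_prod) auto
  also have "\<dots> = ennreal (sqrt (pi * s) ^ card I)"
    by (subst prod.cong[OF refl nn_integral_gaussian[OF assms(2)]]) (use assms in \<open>simp add: ennreal_power zero_le_mult_iff\<close>)
  finally show ?thesis .
qed

section \<open>Product Gaussian density and translations of product Lebesgue measure\<close>

lemma sets_std_gaussian [measurable_cong, simp]: "sets std_gaussian = sets borel"
  by (simp add: std_gaussian_def)

lemma space_std_gaussian [simp]: "space std_gaussian = UNIV"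
  by (simp add: std_gaussian_def)

lemma prob_space_std_gaussian: "prob_space std_gaussian"
  unfolding std_gaussian_def by (rule prob_space_normal_density) simp

lemma PiM_std_gaussian_density:
  assumes "finite I"
  shows "(\<Pi>\<^sub>M i\<in>I. std_gaussian) =
    density (\<Pi>\<^sub>M i\<in>I. lborel) (\<lambda>z. \<Prod>i\<in>I. ennreal (std_normal_density (z i)))"
    (is "?G = ?D")
proof -
  interpret L: product_sigma_finite "\<lambda>_. lborel :: real measure" ..
  interpret G: prob_space std_gaussian by (rule prob_space_std_gaussian)
  interpret PG: product_sigma_finite "\<lambda>_. std_gaussian"
    by unfold_locales
  show ?thesis
  proof (rule PG.PiM_eqI[symmetric])
    show "finite I" by fact
    show "sets ?D = sets (\<Pi>\<^sub>M i\<in>I. std_gaussian)"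
      by (simp, intro sets_PiM_cong) auto
  next
    fix A :: "'a \<Rightarrow> real set" assume A: "\<And>i. i \<in> I \<Longrightarrow> A i \<in> sets std_gaussian"
    have [measurable]: "Pi\<^sub>E I A \<in> sets (\<Pi>\<^sub>M i\<in>I. lborel)"
      using A assms by (intro sets_PiM_I_finite) auto
    \<comment> \<open>The indicator of a box factorises only at extensional \<open>z\<close>, hence
      the restriction to the space of the product.\<close>
    have ind: "indicator (Pi\<^sub>E I A) z = (\<Prod>i\<in>I. indicator (A i) (z i) :: ennreal)"
      if "z \<in> space (\<Pi>\<^sub>M i\<in>I. lborel)" for z
    proof -
      have "z \<in> extensional I" using that by (simp add: space_PiM PiE_def)
      then show ?thesis using assms
        by (auto simp: indicator_def PiE_def Pi_def prod_zero_iff)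
    qed
    have "emeasure ?D (Pi\<^sub>E I A) =
      (\<integral>\<^sup>+ z. (\<Prod>i\<in>I. ennreal (std_normal_density (z i))) * indicator (Pi\<^sub>E I A) z \<partial>(\<Pi>\<^sub>M i\<in>I. lborel))"
      by (simp add: emeasure_density)
    also have "\<dots> = (\<integral>\<^sup>+ z. (\<Prod>i\<in>I. ennreal (std_normal_density (z i)) * indicator (A i) (z i)) \<partial>(\<Pi>\<^sub>M i\<in>I. lborel))"
      by (intro nn_integral_cong) (simp add: ind prod.distrib)
    also have "\<dots> = (\<Prod>i\<in>I. \<integral>\<^sup>+ x. ennreal (std_normal_density x) * indicator (A i) x \<partial>lborel)"
      using assms A by (subst L.product_nn_integral_prod) auto
    also have "\<dots> = (\<Prod>i\<in>I. emeasure std_gaussian (A i))"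
      using A by (intro prod.cong) (auto simp: std_gaussian_def emeasure_density)
    finally show "emeasure ?D (Pi\<^sub>E I A) = (\<Prod>i\<in>I. emeasure std_gaussian (A i))" .
  qed
qed

lemma measurable_PiM_translate [measurable]:
  "(\<lambda>y. \<lambda>i\<in>I. y i + a i) \<in> measurable (\<Pi>\<^sub>M i\<in>I. lborel) (\<Pi>\<^sub>M i\<in>I. lborel :: real measure)"
  by (intro measurable_restrict) (auto intro!: borel_measurable_add measurable_component_singleton simp: measurable_lborel1)

lemma PiM_lborel_translate:
  fixes a :: "'i \<Rightarrow> real"
  assumes "finite I"
  shows "distr (\<Pi>\<^sub>M i\<in>I. lborel) (\<Pi>\<^sub>M i\<in>I. lborel) (\<lambda>y. \<lambda>i\<in>I. y i + a i) = (\<Pi>\<^sub>M i\<in>I. lborel)"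
proof -
  interpret L: product_sigma_finite "\<lambda>_. lborel :: real measure" ..
  show ?thesis
  proof (rule L.PiM_eqI)
    fix A :: "'i \<Rightarrow> real set" assume A: "\<And>i. i \<in> I \<Longrightarrow> A i \<in> sets lborel"
    have pre: "(\<lambda>y. \<lambda>i\<in>I. y i + a i) -` (Pi\<^sub>E I A) \<inter> space (\<Pi>\<^sub>M i\<in>I. lborel)
       = Pi\<^sub>E I (\<lambda>i. (\<lambda>x. x + a i) -` A i)"
      by (auto simp: space_PiM PiE_def Pi_def)
    have m: "(\<lambda>x. x + a i) -` A i \<in> sets borel" if "i \<in> I" for i
    proof -
      have "(\<lambda>x. x + a i) \<in> borel_measurable borel" by simp
      from measurable_sets[OF this, of "A i"] show ?thesis using A[OF that] by simp
    qed
    have "emeasure (distr (\<Pi>\<^sub>M i\<in>I. lborel) (\<Pi>\<^sub>M i\<in>I. lborel) (\<lambda>y. \<lambda>i\<in>I. y i + a i)) (Pi\<^sub>E I A)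
      = emeasure (\<Pi>\<^sub>M i\<in>I. lborel) (Pi\<^sub>E I (\<lambda>i. (\<lambda>x. x + a i) -` A i))"
      using A assms by (subst emeasure_distr) (auto simp: pre intro!: sets_PiM_I_finite)
    also have "\<dots> = (\<Prod>i\<in>I. emeasure lborel ((\<lambda>x. x + a i) -` A i))"
      using m assms by (subst L.emeasure_PiM) auto
    also have "\<dots> = (\<Prod>i\<in>I. emeasure lborel (A i))"
    proof (intro prod.cong refl)
      fix i assume "i \<in> I"
      have "emeasure lborel (A i) = emeasure (distr lborel borel ((+) (a i))) (A i)"
        by (simp add: lborel_distr_plus)
      also have "\<dots> = emeasure lborel ((+) (a i) -` A i)"
        using A[OF \<open>i \<in> I\<close>] by (subst emeasure_distr) auto
      also have "(+) (a i) -` A i = (\<lambda>x. x + a i) -` A i" by (auto simp: add.commute)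
      finally show "emeasure lborel ((\<lambda>x. x + a i) -` A i) = emeasure lborel (A i)" by simp
    qed
    finally show "emeasure (distr (\<Pi>\<^sub>M i\<in>I. lborel) (\<Pi>\<^sub>M i\<in>I. lborel) (\<lambda>y. \<lambda>i\<in>I. y i + a i)) (Pi\<^sub>E I A)
        = (\<Prod>i\<in>I. emeasure lborel (A i))" .
  qed (use assms in auto)
qed

text \<open>Serves to replace the noise \<open>z\<close> by the output \<open>y = x m + z\<close>,
  so that the success probabilities of all messages become integrals over the same variable and can
  be added under one integral.\<close>

lemma nn_integral_PiM_translate:
  fixes a :: "'i \<Rightarrow> real"
  assumes "finite I" "f \<in> borel_measurable (\<Pi>\<^sub>M i\<in>I. lborel)"
  shows "(\<integral>\<^sup>+ z. f z \<partial>(\<Pi>\<^sub>M i\<in>I. lborel)) = (\<integral>\<^sup>+ y. f (\<lambda>i\<in>I. y i + a i) \<partial>(\<Pi>\<^sub>M i\<in>I. lborel))"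
proof -
  have "(\<integral>\<^sup>+ z. f z \<partial>(\<Pi>\<^sub>M i\<in>I. lborel))
     = (\<integral>\<^sup>+ z. f z \<partial>(distr (\<Pi>\<^sub>M i\<in>I. lborel) (\<Pi>\<^sub>M i\<in>I. lborel) (\<lambda>y. \<lambda>i\<in>I. y i + a i)))"
    by (simp add: PiM_lborel_translate[OF assms(1)])
  also have "\<dots> = (\<integral>\<^sup>+ y. f (\<lambda>i\<in>I. y i + a i) \<partial>(\<Pi>\<^sub>M i\<in>I. lborel))"
    using assms(2) by (intro nn_integral_distr) auto
  finally show ?thesis .
qed

text \<open>Young's inequality with a free weight \<open>a\<close>, obtained from the square of
  \<open>a * y - (1 + a) * x\<close>. For \<open>a\<close> of the order of the power, the loss
  \<open>x\<^sup>2 / a\<close> stays bounded while the Gaussian in \<open>y\<close> has variance of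
  order \<open>a\<close>.\<close>

lemma square_diff_ge:
  fixes x y a :: real
  assumes "a > 0"
  shows "(y - x)\<^sup>2 \<ge> y\<^sup>2 / (1 + a) - x\<^sup>2 / a"
proof -
  have "0 \<le> (a * y - (1 + a) * x)\<^sup>2" by simp
  also have "\<dots> = (y - x)\<^sup>2 * (a * (1 + a)) - (a * y\<^sup>2 - (1 + a) * x\<^sup>2)"
    by (simp add: power2_eq_square algebra_simps)
  finally have "(a * y\<^sup>2 - (1 + a) * x\<^sup>2) / (a * (1 + a)) \<le> (y - x)\<^sup>2"
    using assms by (subst pos_divide_le_eq) auto
  moreover have "(a * y\<^sup>2 - (1 + a) * x\<^sup>2) / (a * (1 + a)) = y\<^sup>2 / (1 + a) - x\<^sup>2 / a"
    using assms by (simp add: diff_divide_distrib)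
  ultimately show ?thesis by simp
qed

lemma square_sum_le: "((x::real) + y)\<^sup>2 \<le> 2 * x\<^sup>2 + 2 * y\<^sup>2"
  using sum_squares_ge_zero[of "x - y" 0] by (simp add: power2_eq_square algebra_simps)

text \<open>In the output \<open>y = x m + z\<close>, the indices \<open>IA\<close> are observed. By \<open>coarse\<close>, the candidates \<open>m\<close> for a
  given observation are such that \<open>x m\<close> on \<open>IB\<close> differs from that of the candidate \<open>m0\<close> nearest to the
  observation by at most a multiple of the noise on \<open>IA\<close>. The likelihood is therefore dominated by a
  Gaussian around \<open>x m0\<close>, and the unobserved coordinates contribute a factor that does not depend on the
  energy \<open>E\<close>.\<close>

lemma gaussian_packing:
  fixes x :: "'m \<Rightarrow> 'i \<Rightarrow> real" and G :: "'m \<Rightarrow> ('i \<Rightarrow> real) set"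
  assumes fin: "finite IA" "finite IB" "IA \<inter> IB = {}" "finite W"
    and G: "\<And>m. m \<in> W \<Longrightarrow> G m \<in> sets (\<Pi>\<^sub>M i\<in>IA \<union> IB. std_gaussian)"
    and ident: "\<And>m m' z z'. \<lbrakk>m \<in> W; m' \<in> W; z \<in> G m; z' \<in> G m';
        \<And>i. i \<in> IA \<union> IB \<Longrightarrow> x m i + z i = x m' i + z' i\<rbrakk> \<Longrightarrow> m = m'"
    and coarse: "\<And>m m' z z'. \<lbrakk>m \<in> W; m' \<in> W; z \<in> G m; z' \<in> G m';
        \<And>i. i \<in> IA \<Longrightarrow> x m i + z i = x m' i + z' i\<rbrakk> \<Longrightarrow>
        (\<Sum>i\<in>IB. (x m i - x m' i)\<^sup>2) \<le> C * (\<Sum>i\<in>IA. (x m i - x m' i)\<^sup>2)"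
    and energy: "\<And>m. m \<in> W \<Longrightarrow> (\<Sum>i\<in>IA. (x m i)\<^sup>2) \<le> E"
    and "a > 0" "C \<ge> 1"
  shows "(\<Sum>m\<in>W. measure (\<Pi>\<^sub>M i\<in>IA \<union> IB. std_gaussian) (G m))
         \<le> sqrt (2 * (1 + a)) ^ card IA * sqrt (16 * C) ^ card IB * exp (E / (4 * a))"
proof -
  interpret L: product_sigma_finite "\<lambda>_. lborel :: real measure" ..
  define I where "I = IA \<union> IB"
  have fI: "finite I" using fin by (simp add: I_def)
  let ?L = "\<Pi>\<^sub>M i\<in>I. (lborel :: real measure)"
  let ?\<gamma> = "\<Pi>\<^sub>M i\<in>I. std_gaussian"
  interpret P: prob_space ?\<gamma> by (intro prob_space_PiM) (rule prob_space_std_gaussian)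
  define \<phi> where "\<phi> z = (\<Prod>i\<in>I. ennreal (std_normal_density (z i)))" for z
  define T where "T m y = (\<lambda>i\<in>I. y i + (- x m i))" for m y
  have Tm [measurable]: "T m \<in> measurable ?L ?L" for m
    unfolding T_def by (rule measurable_PiM_translate)
  have \<phi>m [measurable]: "\<phi> \<in> borel_measurable ?L"
    unfolding \<phi>_def by (intro borel_measurable_prod_ennreal) measurable
  have GL [measurable]: "G m \<in> sets ?L" if "m \<in> W" for m
  proof -
    have "sets ?L = sets ?\<gamma>" by (intro sets_PiM_cong) auto
    then show ?thesis using G[OF that] by (simp add: I_def)
  qed
  \<comment> \<open>\<open>F y\<close> is the total likelihood of successful decoding at the output
    \<open>y\<close>. By \<open>ident\<close> at most one summand is nonzero.\<close>
  define F where "F y = (\<Sum>m\<in>W. \<phi> (T m y) * indicator (G m) (T m y))" for y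
  have em: "emeasure ?\<gamma> (G m) = (\<integral>\<^sup>+ y. \<phi> (T m y) * indicator (G m) (T m y) \<partial>?L)" if "m \<in> W" for m
  proof -
    have "emeasure ?\<gamma> (G m) = (\<integral>\<^sup>+ z. \<phi> z * indicator (G m) z \<partial>?L)"
      unfolding PiM_std_gaussian_density[OF fI] \<phi>_def[symmetric]
      using that by (intro emeasure_density) auto
    also have "\<dots> = (\<integral>\<^sup>+ y. \<phi> (T m y) * indicator (G m) (T m y) \<partial>?L)"
      unfolding T_def using that by (intro nn_integral_PiM_translate[OF fI]) measurable
    finally show ?thesis .
  qed
  have Fm: "F \<in> borel_measurable ?L"
    unfolding F_def
  proof (intro borel_measurable_sum)
    fix m assume "m \<in> W"
    note GL[OF this, measurable]
    show "(\<lambda>y. \<phi> (T m y) * indicator (G m) (T m y)) \<in> borel_measurable ?L" by measurable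
  qed
  have sumF: "(\<Sum>m\<in>W. emeasure ?\<gamma> (G m)) = (\<integral>\<^sup>+ y. F y \<partial>?L)"
  proof -
    have "(\<integral>\<^sup>+ y. F y \<partial>?L) = (\<Sum>m\<in>W. \<integral>\<^sup>+ y. \<phi> (T m y) * indicator (G m) (T m y) \<partial>?L)"
      unfolding F_def
    proof (intro nn_integral_sum)
      fix m assume "m \<in> W"
      note GL[OF this, measurable]
      show "(\<lambda>y. \<phi> (T m y) * indicator (G m) (T m y)) \<in> borel_measurable ?L" by measurable
    qed
    then show ?thesis using em by simp
  qed
  define \<kappa> where "\<kappa> = (1 / sqrt (2 * pi)) ^ card I * exp (E / (4 * a))"
  have \<kappa>0: "\<kappa> \<ge> 0" by (simp add: \<kappa>_def)
  \<comment> \<open>The exponent is \<open>- (SA + SB) / 2\<close>. One \<open>SA / 4\<close> is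
    kept for a Gaussian around 0 on \<open>IA\<close>; the rest, \<open>SA / 4 + SB / 2\<close>,
    pays for moving the centre on \<open>IB\<close> from \<open>x m\<close> to \<open>x m0\<close>.
    Since \<open>m0\<close> is at least as near to \<open>y\<close> on \<open>IA\<close> as
    \<open>m\<close>, the two signals differ there by at most \<open>4 * SA\<close>, and
    \<open>C\<close> carries this over to \<open>IB\<close>.\<close>
  have exponent: "- (\<Sum>i\<in>I. (y i - x m i)\<^sup>2) / 2 \<le>
      E / (4 * a) - (\<Sum>i\<in>IA. (y i)\<^sup>2) / (4 * (1 + a)) - (\<Sum>i\<in>IB. (y i - x m0 i)\<^sup>2) / (32 * C)"
    if W: "m \<in> W" "m0 \<in> W"
      and near: "(\<Sum>i\<in>IA. (y i - x m0 i)\<^sup>2) \<le> (\<Sum>i\<in>IA. (y i - x m i)\<^sup>2)"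
      and co: "(\<Sum>i\<in>IB. (x m i - x m0 i)\<^sup>2) \<le> C * (\<Sum>i\<in>IA. (x m i - x m0 i)\<^sup>2)"
    for y :: "'i \<Rightarrow> real" and m m0
  proof -
    define SA where "SA = (\<Sum>i\<in>IA. (y i - x m i)\<^sup>2)"
    define SB where "SB = (\<Sum>i\<in>IB. (y i - x m i)\<^sup>2)"
    have 1: "(\<Sum>i\<in>I. (y i - x m i)\<^sup>2) = SA + SB"
      unfolding I_def SA_def SB_def using fin by (simp add: sum.union_disjoint)
    have "(\<Sum>i\<in>IA. (y i)\<^sup>2 / (1 + a) - (x m i)\<^sup>2 / a) \<le> SA"
      unfolding SA_def by (intro sum_mono square_diff_ge \<open>a > 0\<close>)
    then have "(\<Sum>i\<in>IA. (y i)\<^sup>2) / (1 + a) - (\<Sum>i\<in>IA. (x m i)\<^sup>2) / a \<le> SA"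
      by (simp add: sum_subtractf sum_divide_distrib)
    moreover have "(\<Sum>i\<in>IA. (x m i)\<^sup>2) / a \<le> E / a"
      using energy[OF W(1)] \<open>a > 0\<close> by (simp add: divide_right_mono)
    ultimately have 2: "(\<Sum>i\<in>IA. (y i)\<^sup>2) / (1 + a) - E / a \<le> SA" by simp
    have "(\<Sum>i\<in>IA. (x m i - x m0 i)\<^sup>2) \<le> (\<Sum>i\<in>IA. 2 * (y i - x m0 i)\<^sup>2 + 2 * (y i - x m i)\<^sup>2)"
    proof (intro sum_mono)
      fix i
      show "(x m i - x m0 i)\<^sup>2 \<le> 2 * (y i - x m0 i)\<^sup>2 + 2 * (y i - x m i)\<^sup>2"
        using square_sum_le[of "y i - x m0 i" "- (y i - x m i)"] by (simp add: algebra_simps power2_commute)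
    qed
    also have "\<dots> \<le> 4 * SA" using near by (simp add: sum.distrib SA_def flip: sum_distrib_left)
    finally have "C * (\<Sum>i\<in>IA. (x m i - x m0 i)\<^sup>2) \<le> C * (4 * SA)"
      using \<open>C \<ge> 1\<close> by (intro mult_left_mono) auto
    then have 3: "(\<Sum>i\<in>IB. (x m i - x m0 i)\<^sup>2) \<le> 4 * C * SA" using co by simp
    have "(\<Sum>i\<in>IB. (y i - x m0 i)\<^sup>2) \<le> (\<Sum>i\<in>IB. 2 * (y i - x m i)\<^sup>2 + 2 * (x m i - x m0 i)\<^sup>2)"
    proof (intro sum_mono)
      fix i
      show "(y i - x m0 i)\<^sup>2 \<le> 2 * (y i - x m i)\<^sup>2 + 2 * (x m i - x m0 i)\<^sup>2"
        using square_sum_le[of "y i - x m i" "x m i - x m0 i"] by simp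
    qed
    also have "\<dots> \<le> 2 * SB + 8 * C * SA"
      using 3 by (simp add: sum.distrib SB_def flip: sum_distrib_left)
    also have "2 * SB \<le> 16 * C * SB"
      using \<open>C \<ge> 1\<close> by (intro mult_right_mono) (auto simp: SB_def intro: sum_nonneg)
    finally have "(\<Sum>i\<in>IB. (y i - x m0 i)\<^sup>2) \<le> (SB / 2 + SA / 4) * (32 * C)"
      by (simp add: algebra_simps)
    then have 4: "(\<Sum>i\<in>IB. (y i - x m0 i)\<^sup>2) / (32 * C) \<le> SB / 2 + SA / 4"
      using \<open>C \<ge> 1\<close> by (simp add: pos_divide_le_eq)
    have 5: "(\<Sum>i\<in>IA. (y i)\<^sup>2) / (4 * (1 + a)) = (\<Sum>i\<in>IA. (y i)\<^sup>2) / (1 + a) / 4"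
       "E / (4 * a) = E / a / 4" by (simp_all add: mult.commute)
    have "- (u + v) / 2 \<le> q / 4 - p / 4 - r" if "p - q \<le> u" "r \<le> v / 2 + u / 4" for p q r u v :: real
      using that by (simp add: field_simps)
    from this[OF 2 4] show ?thesis unfolding 1 5 .
  qed
  have bound: "\<exists>b. \<forall>yB \<in> space (\<Pi>\<^sub>M i\<in>IB. (lborel :: real measure)). F (merge IA IB (yA, yB)) \<le>
      ennreal (\<kappa> * exp (- (\<Sum>i\<in>IA. (yA i - 0)\<^sup>2) / (4 * (1 + a)))) *
      ennreal (exp (- (\<Sum>i\<in>IB. (yB i - b i)\<^sup>2) / (32 * C)))" for yA
  proof -
    \<comment> \<open>\<open>V\<close> and the nearest candidate \<open>m0\<close> depend on
      \<open>yA\<close> alone, so the Gaussian in \<open>yB\<close> has a fixed centre while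
      \<open>yB\<close> is integrated. If \<open>V\<close> is empty, \<open>F\<close> vanishes for
      every \<open>yB\<close> and \<open>m0\<close> is arbitrary.\<close>
    define V where "V = {m \<in> W. \<exists>yB. T m (merge IA IB (yA, yB)) \<in> G m}"
    have finV: "finite V" using fin by (simp add: V_def)
    define d where "d m = (\<Sum>i\<in>IA. (yA i - x m i)\<^sup>2)" for m
    define m0 where "m0 = (if V = {} then undefined else arg_min_on d V)"
    have m0: "m0 \<in> V" "d m0 \<le> d m" if "m \<in> V" for m
      using that finV arg_min_if_finite[of V d] arg_min_least[of V m d] by (auto simp: m0_def)
    have "F (merge IA IB (yA, yB)) \<le>
      ennreal (\<kappa> * exp (- (\<Sum>i\<in>IA. (yA i - 0)\<^sup>2) / (4 * (1 + a)))) *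
      ennreal (exp (- (\<Sum>i\<in>IB. (yB i - x m0 i)\<^sup>2) / (32 * C)))" for yB
    proof (cases "\<exists>m\<in>W. T m (merge IA IB (yA, yB)) \<in> G m")
      case False
      then show ?thesis by (simp add: F_def)
    next
      case True
      define y where "y = merge IA IB (yA, yB)"
      have yA: "y i = yA i" if "i \<in> IA" for i
        using that by (simp add: y_def merge_def)
      have yB: "y i = yB i" if "i \<in> IB" for i
        using that fin by (auto simp: y_def merge_def)
      obtain m where m: "m \<in> W" "T m y \<in> G m" using True by (auto simp: y_def)
      then have mV: "m \<in> V" by (auto simp: V_def y_def)
      then have m0W: "m0 \<in> W" using m0[OF mV] by (auto simp: V_def)
      obtain yB0 where yB0: "T m0 (merge IA IB (yA, yB0)) \<in> G m0"
        using m0(1)[OF mV] by (auto simp: V_def)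
      have "F y = (\<Sum>m'\<in>{m}. \<phi> (T m' y) * indicator (G m') (T m' y))"
        unfolding F_def
      proof (intro sum.mono_neutral_right fin)
        show "\<forall>i\<in>W - {m}. \<phi> (T i y) * indicator (G i) (T i y) = 0"
        proof
          fix m' assume m': "m' \<in> W - {m}"
          have "T m' y \<notin> G m'"
          proof
            assume "T m' y \<in> G m'"
            then have "m' = m" using m m'
              by (intro ident[of m' m "T m' y" "T m y"]) (auto simp: T_def I_def)
            then show False using m' by simp
          qed
          then show "\<phi> (T m' y) * indicator (G m') (T m' y) = 0" by simp
        qed
      qed (use m in auto)
      also have "\<dots> = \<phi> (T m y)" using m(2) by (subst sum.insert) auto
      also have "\<phi> (T m y) = ennreal ((1 / sqrt (2 * pi)) ^ card I * exp (- (\<Sum>i\<in>I. (y i - x m i)\<^sup>2) / 2))"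
        using fI by (simp add: \<phi>_def T_def prod_ennreal std_normal_density_def prod.distrib
            exp_sum sum_negf sum_divide_distrib prod_dividef power_divide flip: exp_sum)
      also have "\<dots> \<le> ennreal ((1 / sqrt (2 * pi)) ^ card I *
          exp (E / (4 * a) - (\<Sum>i\<in>IA. (y i)\<^sup>2) / (4 * (1 + a)) - (\<Sum>i\<in>IB. (y i - x m0 i)\<^sup>2) / (32 * C)))"
      proof (intro ennreal_leI mult_left_mono iffD2[OF exp_le_cancel_iff] exponent m(1) m0W)
        show "(\<Sum>i\<in>IA. (y i - x m0 i)\<^sup>2) \<le> (\<Sum>i\<in>IA. (y i - x m i)\<^sup>2)"
          using m0(2)[OF mV] by (simp add: d_def yA)
        show "(\<Sum>i\<in>IB. (x m i - x m0 i)\<^sup>2) \<le> C * (\<Sum>i\<in>IA. (x m i - x m0 i)\<^sup>2)"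
          by (rule coarse[OF m(1) m0W m(2) yB0]) (auto simp: T_def I_def yA merge_def)
      qed simp
      also have "\<dots> = ennreal (\<kappa> * exp (- (\<Sum>i\<in>IA. (yA i - 0)\<^sup>2) / (4 * (1 + a)))) *
          ennreal (exp (- (\<Sum>i\<in>IB. (yB i - x m0 i)\<^sup>2) / (32 * C)))"
        using \<kappa>0 by (simp add: yA yB \<kappa>_def exp_diff exp_minus exp_add field_simps flip: ennreal_mult)
      finally show ?thesis by (simp add: y_def)
    qed
    then show ?thesis by blast
  qed
  \<comment> \<open>The Gaussian integral has the same value for every centre \<open>b\<close>, so
    \<open>b\<close> disappears and its dependence on \<open>yA\<close> need not be
    measurable.\<close>
  have inner: "(\<integral>\<^sup>+ yB. F (merge IA IB (yA, yB)) \<partial>(\<Pi>\<^sub>M i\<in>IB. lborel)) \<le>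
      ennreal (\<kappa> * sqrt (pi * (32 * C)) ^ card IB) *
        ennreal (exp (- (\<Sum>i\<in>IA. (yA i - 0)\<^sup>2) / (4 * (1 + a))))" for yA
  proof -
    obtain b where b: "\<forall>yB \<in> space (\<Pi>\<^sub>M i\<in>IB. (lborel :: real measure)). F (merge IA IB (yA, yB)) \<le>
      ennreal (\<kappa> * exp (- (\<Sum>i\<in>IA. (yA i - 0)\<^sup>2) / (4 * (1 + a)))) *
      ennreal (exp (- (\<Sum>i\<in>IB. (yB i - b i)\<^sup>2) / (32 * C)))"
      using bound[of yA] by blast
    have "(\<integral>\<^sup>+ yB. F (merge IA IB (yA, yB)) \<partial>(\<Pi>\<^sub>M i\<in>IB. lborel)) \<le>
      (\<integral>\<^sup>+ yB. ennreal (\<kappa> * exp (- (\<Sum>i\<in>IA. (yA i - 0)\<^sup>2) / (4 * (1 + a)))) *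
      ennreal (exp (- (\<Sum>i\<in>IB. (yB i - b i)\<^sup>2) / (32 * C))) \<partial>(\<Pi>\<^sub>M i\<in>IB. lborel))"
      using b by (intro nn_integral_mono) blast
    also have "\<dots> = ennreal (\<kappa> * exp (- (\<Sum>i\<in>IA. (yA i - 0)\<^sup>2) / (4 * (1 + a)))) *
       (\<integral>\<^sup>+ yB. ennreal (exp (- (\<Sum>i\<in>IB. (yB i - b i)\<^sup>2) / (32 * C))) \<partial>(\<Pi>\<^sub>M i\<in>IB. lborel))"
      by (intro nn_integral_cmult) measurable
    also have "\<dots> = ennreal (\<kappa> * exp (- (\<Sum>i\<in>IA. (yA i - 0)\<^sup>2) / (4 * (1 + a)))) *
        ennreal (sqrt (pi * (32 * C)) ^ card IB)"
      using \<open>C \<ge> 1\<close> fin by (subst nn_integral_PiM_gaussian) auto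
    also have "\<dots> = ennreal (\<kappa> * sqrt (pi * (32 * C)) ^ card IB) *
        ennreal (exp (- (\<Sum>i\<in>IA. (yA i - 0)\<^sup>2) / (4 * (1 + a))))"
      using \<kappa>0 \<open>C \<ge> 1\<close> by (simp add: mult_ac flip: ennreal_mult)
    finally show ?thesis .
  qed
  have "(\<integral>\<^sup>+ y. F y \<partial>?L) =
      (\<integral>\<^sup>+ yA. (\<integral>\<^sup>+ yB. F (merge IA IB (yA, yB)) \<partial>(\<Pi>\<^sub>M i\<in>IB. lborel)) \<partial>(\<Pi>\<^sub>M i\<in>IA. lborel))"
    unfolding I_def using Fm fin by (intro L.product_nn_integral_fold) (auto simp: I_def)
  also have "\<dots> \<le> (\<integral>\<^sup>+ yA. ennreal (\<kappa> * sqrt (pi * (32 * C)) ^ card IB) *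
        ennreal (exp (- (\<Sum>i\<in>IA. (yA i - 0)\<^sup>2) / (4 * (1 + a)))) \<partial>(\<Pi>\<^sub>M i\<in>IA. lborel))"
    by (intro nn_integral_mono inner)
  also have "\<dots> = ennreal (\<kappa> * sqrt (pi * (32 * C)) ^ card IB) *
     (\<integral>\<^sup>+ yA. ennreal (exp (- (\<Sum>i\<in>IA. (yA i - 0)\<^sup>2) / (4 * (1 + a)))) \<partial>(\<Pi>\<^sub>M i\<in>IA. lborel))"
    by (intro nn_integral_cmult) measurable
  also have "\<dots> = ennreal (\<kappa> * sqrt (pi * (32 * C)) ^ card IB) * ennreal (sqrt (pi * (4 * (1 + a))) ^ card IA)"
    using fin \<open>a > 0\<close> by (subst nn_integral_PiM_gaussian) auto
  also have "\<dots> = ennreal (\<kappa> * sqrt (pi * (32 * C)) ^ card IB * sqrt (pi * (4 * (1 + a))) ^ card IA)"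
    using \<kappa>0 \<open>C \<ge> 1\<close> \<open>a > 0\<close> by (simp flip: ennreal_mult)
  also have "\<kappa> * sqrt (pi * (32 * C)) ^ card IB * sqrt (pi * (4 * (1 + a))) ^ card IA =
     sqrt (2 * (1 + a)) ^ card IA * sqrt (16 * C) ^ card IB * exp (E / (4 * a))"
  proof -
    have "card I = card IA + card IB" unfolding I_def using fin by (simp add: card_Un_disjoint)
    \<comment> \<open>The factors \<open>sqrt (2 * pi)\<close> split off here cancel the
      normalisation of the noise density contained in \<open>\<kappa>\<close>.\<close>
    moreover have "sqrt (pi * (32 * C)) = sqrt (2 * pi) * sqrt (16 * C)"
      "sqrt (pi * (4 * (1 + a))) = sqrt (2 * pi) * sqrt (2 * (1 + a))"
      by (simp_all flip: real_sqrt_mult add: algebra_simps)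
    ultimately show ?thesis
      by (simp only: \<kappa>_def power_add power_mult_distrib power_divide) (simp add: field_simps)
  qed
  finally have "(\<Sum>m\<in>W. emeasure ?\<gamma> (G m)) \<le>
      ennreal (sqrt (2 * (1 + a)) ^ card IA * sqrt (16 * C) ^ card IB * exp (E / (4 * a)))"
    using sumF by simp
  then have "ennreal (\<Sum>m\<in>W. measure ?\<gamma> (G m)) \<le>
      ennreal (sqrt (2 * (1 + a)) ^ card IA * sqrt (16 * C) ^ card IB * exp (E / (4 * a)))"
    by (simp add: P.emeasure_eq_measure)
  then show ?thesis
    unfolding I_def[symmetric] using \<open>C \<ge> 1\<close> \<open>a > 0\<close> by (subst (asm) ennreal_le_iff) auto
qed

section \<open>Receiver pattern and locality of cooperation\<close>

text \<open>The receivers are cut into blocks of length \<open>2 D + 4\<close>, of which the last two are dropped. The two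
  middle users of a block are its centres: the receivers that influence what has to be decoded there
  are exactly the observed ones of the block. The last complete block is not dropped from, so that every
  dropped receiver lies between two complete blocks.\<close>

definition dropped :: "nat \<Rightarrow> nat \<Rightarrow> nat set" where
  "dropped K D = {k \<in> {1..K}. k + (2 * D + 4) \<le> (2 * D + 4) * (K div (2 * D + 4)) \<and>
     (k mod (2 * D + 4) = 0 \<or> k mod (2 * D + 4) = 2 * D + 3)}"

definition observed :: "nat \<Rightarrow> nat \<Rightarrow> nat set" where
  "observed K D = {1..K} - dropped K D"

definition centres :: "nat \<Rightarrow> nat \<Rightarrow> nat set" where
  "centres K D = (\<Union>q<K div (2 * D + 4). {q * (2 * D + 4) + D + 1, q * (2 * D + 4) + D + 2})"

lemma finite_dropped [simp]: "finite (dropped K D)" and finite_observed [simp]: "finite (observed K D)"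
  by (auto simp: dropped_def observed_def)

lemma observed_Un_dropped: "observed K D \<union> dropped K D = {1..K}"
  and observed_Int_dropped: "observed K D \<inter> dropped K D = {}"
  by (auto simp: dropped_def observed_def)

text \<open>Between any two consecutive complete blocks there is one dropped pair,
  \<open>q * p + 2 * D + 3\<close> and \<open>Suc q * p\<close>. Residues modulo \<open>p\<close>
  tell its two members apart.\<close>

lemma card_dropped_ge:
  assumes "p = 2 * D + 4" "Q = K div p"
  shows "2 * (Q - 1) \<le> card (dropped K D)"
proof -
  define f where "f = (\<lambda>(q, b). if b then Suc q * p else q * p + 2 * D + 3)"
  have inj: "inj_on f ({..<Q - 1} \<times> UNIV)"
  proof (rule inj_onI, clarsimp simp: f_def split: if_splits)
    fix q q' :: nat
    { assume "p + q * p = q' * p + 2 * D + 3"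
      then have "(p + q * p) mod p = (q' * p + (2 * D + 3)) mod p" by (simp add: add.assoc)
      then show False using assms(1) by simp }
    { assume "q * p + 2 * D + 3 = p + q' * p"
      then have "(q * p + (2 * D + 3)) mod p = (p + q' * p) mod p" by (simp add: add.assoc)
      then show False using assms(1) by simp }
  qed (use assms in auto)
  have sub: "f ` ({..<Q - 1} \<times> UNIV) \<subseteq> dropped K D"
  proof (clarsimp simp: f_def)
    fix q b assume q: "q < Q - Suc 0"
    have "(Suc q + 1) * p \<le> Q * p" using q by (intro mult_right_mono) auto
    then have 1: "Suc q * p + p \<le> Q * p" by simp
    have 2: "Q * p \<le> K" by (simp add: assms(2))
    have 3: "q * p + 2 * D + 3 < Suc q * p" using assms(1) by simp
    have p0: "p > 0" using assms(1) by simp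
    have "(q * p + (2 * D + 3)) mod p = 2 * D + 3" using assms(1) by simp
    then show "(b \<longrightarrow> p + q * p \<in> dropped K D) \<and> (\<not> b \<longrightarrow> q * p + 2 * D + 3 \<in> dropped K D)"
      using 1 2 3 p0 unfolding dropped_def assms(1)[symmetric] assms(2)[symmetric]
      by (auto simp: mult.commute add.assoc)
  qed
  have "2 * (Q - 1) = card (f ` ({..<Q - 1} \<times> UNIV))"
    using inj by (simp add: card_image card_cartesian_product)
  also have "\<dots> \<le> card (dropped K D)" using sub by (intro card_mono) auto
  finally show ?thesis .
qed

text \<open>The excess 4 consists of 2 for the pair kept at the last complete block and 2 for the
  incomplete rest, which has fewer than \<open>2 * D + 4\<close> users.\<close>

lemma card_observed_le:
  "real (card (observed K D)) \<le> real K * ((real D + 1) / (real D + 2)) + 4"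
proof -
  define p where "p = 2 * D + 4"
  define Q where "Q = K div p"
  have "card (observed K D) + card (dropped K D) = K"
    by (subst card_Un_disjoint[symmetric]) (simp_all add: observed_Un_dropped observed_Int_dropped)
  moreover have "2 * (Q - 1) \<le> card (dropped K D)" by (rule card_dropped_ge) (auto simp: p_def Q_def)
  ultimately have 1: "real (card (observed K D)) \<le> real K - 2 * real Q + 2" by linarith
  have "K = Q * p + K mod p" by (simp add: Q_def)
  moreover have "K mod p < p" by (simp add: p_def)
  ultimately have "K \<le> Q * p + p" by linarith
  then have "real K \<le> (real Q + 1) * (2 * (real D + 2))"
    unfolding p_def of_nat_le_iff[where 'a=real, symmetric] by (simp add: algebra_simps)
  then have "real K / (real D + 2) \<le> 2 * (real Q + 1)"
    by (simp add: pos_divide_le_eq algebra_simps)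
  moreover have "real K * ((real D + 1) / (real D + 2)) = real K - real K / (real D + 2)"
    by (simp add: field_simps)
  ultimately show ?thesis using 1 by simp
qed

section \<open>Propagation of bounds on the inputs outwards from the centres\<close>

primrec growth :: "real \<Rightarrow> nat \<Rightarrow> real" where
  "growth h 0 = 0"
| "growth h (Suc i) = h * (1 + 2 * h * growth h i)"

lemma growth_nonneg: "h \<ge> 0 \<Longrightarrow> growth h i \<ge> 0"
  by (induction i) auto

lemma growth_mono:
  assumes "h \<ge> 1" "i \<le> j"
  shows "growth h i \<le> growth h j"
proof (rule lift_Suc_mono_le[OF _ assms(2)])
  fix i
  have g: "growth h i \<ge> 0" using growth_nonneg assms by simp
  have "1 * growth h i \<le> (2 * h * h) * growth h i"
    using assms mult_mono[of 1 h 1 h] by (intro mult_right_mono g) auto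
  then show "growth h i \<le> growth h (Suc i)" using assms by (simp add: algebra_simps)
qed

text \<open>Since \<open>growth\<close> is monotone, both predecessors can be estimated by the later
  one; this merges the two terms of the recursion into the single \<open>2 * h * growth h i\<close>
  in the definition of \<open>growth\<close>.\<close>

lemma recursion_bound:
  fixes b :: "nat \<Rightarrow> real"
  assumes h: "h \<ge> 1" and S: "S \<ge> 0" and b0: "b 0 = 0" "b 1 = 0"
    and step: "\<And>i. i \<le> n \<Longrightarrow> b (i + 2) \<le> h * (S + h * b (i + 1) + h * b i)"
  shows "i \<le> n + 2 \<Longrightarrow> b i \<le> growth h i * S"
proof (induction i rule: less_induct)
  case (less i)
  consider "i = 0" | "i = 1" | j where "i = j + 2" "j \<le> n"
    using less.prems by (cases i; cases "i - 1") auto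
  then show ?case
  proof cases
    case 3
    have 1: "b (j + 1) \<le> growth h (j + 1) * S" using less.IH[of "j + 1"] 3 by simp
    have "b j \<le> growth h j * S" using less.IH[of j] 3 by simp
    also have "\<dots> \<le> growth h (j + 1) * S" by (intro mult_right_mono growth_mono h S) auto
    finally have 2: "b j \<le> growth h (j + 1) * S" .
    have "b i \<le> h * (S + h * b (j + 1) + h * b j)" using step 3 by simp
    also have "\<dots> \<le> h * (S + h * (growth h (j + 1) * S) + h * (growth h (j + 1) * S))"
      using h 1 2 by (intro mult_left_mono add_mono order.refl) auto
    also have "\<dots> = growth h i * S" by (simp add: 3 algebra_simps)
    finally show ?thesis .
  qed (use b0 h S in auto)
qed

lemma mod_add_mult_lt: "(b::nat) < p \<Longrightarrow> (q * p + b) mod p = b"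
  by simp

lemma block_observed:
  assumes "q < K div (2 * D + 4)" "q * (2 * D + 4) + 1 \<le> k" "k \<le> q * (2 * D + 4) + 2 * D + 2"
  shows "k \<in> observed K D"
proof -
  define p where "p = 2 * D + 4"
  obtain b where b: "k = q * p + b" "1 \<le> b" "b \<le> 2 * D + 2"
    using assms by (intro that[of "k - q * p"]) (auto simp: p_def)
  have "k mod p = b" unfolding b(1) using b by (intro mod_add_mult_lt) (auto simp: p_def)
  moreover have "k \<le> K"
  proof -
    have "(q + 1) * p \<le> (K div p) * p" using assms by (intro mult_right_mono) (auto simp: p_def)
    also have "\<dots> \<le> K" by simp
    finally show ?thesis using b by (simp add: p_def)
  qed
  ultimately show ?thesis using b unfolding observed_def dropped_def p_def[symmetric]
    by (auto simp: p_def)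
qed

text \<open>Starting from the centres, each observed output determines the next input further out, so inputs
  that vanish at the centres are controlled by the observed outputs.\<close>

lemma dropped_coercive:
  fixes H :: "nat \<Rightarrow> nat \<Rightarrow> real ^ ('l::finite) ^ 'l" and x :: "nat \<Rightarrow> real ^ 'l"
  assumes h: "h \<ge> 1"
    and up: "\<And>k k' v. \<lbrakk>k \<in> {1..K}; k' \<in> {k - 1, k, k + 1}\<rbrakk> \<Longrightarrow> norm (H k' k *v v) \<le> h * norm v"
    and low: "\<And>k k' v. \<lbrakk>k \<in> {1..K}; k' \<in> {k - 1, k, k + 1}; k' \<ge> 1\<rbrakk> \<Longrightarrow> norm v \<le> h * norm (H k' k *v v)"
    and x0: "x 0 = 0" and xc: "\<And>k. k \<in> centres K D \<Longrightarrow> x k = 0"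
    and r: "\<And>k. r k = H k k *v x k + H (k - 1) k *v x (k - 1) + H (k + 1) k *v x (k + 1)"
    and S: "S \<ge> 0" "\<And>k. k \<in> observed K D \<Longrightarrow> norm (r k) \<le> S"
    and k: "k \<in> dropped K D"
  shows "norm (r k) \<le> 3 * h * growth h (D + 2) * S"
proof -
  define p where "p = 2 * D + 4"
  define Q where "Q = K div p"
  define g where "g = growth h (D + 2)"
  have obs1: "k \<in> {1..K}" if "k \<in> observed K D" for k using that by (auto simp: observed_def)
  have block: "norm (x j) \<le> g * S" if q: "q < Q" and j: "q * p \<le> j" "j \<le> q * p + (p - 1)" for q j
  proof -
    \<comment> \<open>\<open>s\<close> and \<open>s + 1\<close> are the centres of the block. With
      the block counted from \<open>q * p\<close>, both of its ends are reached at index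
      \<open>D + 2\<close> of the recursions, rightwards from \<open>s\<close> and leftwards from
      \<open>s + 1\<close>.\<close>
    define s where "s = q * p + D + 1"
    have cs: "x s = 0" "x (s + 1) = 0"
      using q by (auto intro!: xc simp: centres_def s_def Q_def p_def)
    have ob: "k \<in> observed K D" if "q * p + 1 \<le> k" "k \<le> q * p + 2 * D + 2" for k
      using that q by (intro block_observed[of q]) (auto simp: p_def Q_def)
    have step: "norm u \<le> h * (S + h * norm v + h * norm w)"
      if "y = A *v u + B *v v + C *v w" "norm y \<le> S" "norm u \<le> h * norm (A *v u)"
        "norm (B *v v) \<le> h * norm v" "norm (C *v w) \<le> h * norm w"
      for A B C :: "real ^ 'l ^ 'l" and u v w y
    proof -
      have "A *v u = y - B *v v - C *v w" using that(1) by simp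
      then have "norm (A *v u) \<le> norm y + norm (B *v v) + norm (C *v w)"
        by (metis (no_types) add_mono norm_triangle_ineq4 order.refl order.trans)
      then have "norm (A *v u) \<le> S + h * norm v + h * norm w" using that by linarith
      then have "h * norm (A *v u) \<le> h * (S + h * norm v + h * norm w)"
        using h by (intro mult_left_mono) auto
      then show ?thesis using that(3) by linarith
    qed
    have right: "norm (x (s + i)) \<le> growth h i * S" if "i \<le> D + 2" for i
    proof (rule recursion_bound[where n = D])
      fix i assume i: "i \<le> D"
      have o: "s + i + 1 \<in> observed K D" using i by (intro ob) (auto simp: s_def)
      have "r (s + i + 1) = H (s + i + 2) (s + i + 1) *v x (s + i + 2) +
          H (s + i + 1) (s + i + 1) *v x (s + i + 1) + H (s + i) (s + i + 1) *v x (s + i)"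
        by (simp add: r add_ac)
      from step[OF this S(2)[OF o] low[OF obs1[OF o]] up[OF obs1[OF o]] up[OF obs1[OF o]]]
      show "norm (x (s + (i + 2))) \<le> h * (S + h * norm (x (s + (i + 1))) + h * norm (x (s + i)))"
        by (simp add: add_ac)
    qed (use that h S cs in auto)
    \<comment> \<open>The mirror image: the indices 0 and 1 are again the two centres, in reverse
      order.\<close>
    have left: "norm (x (s + 1 - i)) \<le> growth h i * S" if "i \<le> D + 2" for i
    proof (rule recursion_bound[where n = D])
      fix i assume i: "i \<le> D"
      show "norm (x (s + 1 - (i + 2))) \<le> h * (S + h * norm (x (s + 1 - (i + 1))) + h * norm (x (s + 1 - i)))"
      proof (cases "s - i - 1 = 0")
        \<comment> \<open>This happens only in the first block at \<open>i = D\<close>. The next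
          input belongs to the nonexistent user 0, for which \<open>low\<close> says nothing, but it
          is 0 by \<open>x0\<close>.\<close>
        case True
        then have "x (s + 1 - (i + 2)) = 0" using x0 by (simp add: numeral_2_eq_2)
        then show ?thesis using h S by simp
      next
        case False
        define k where "k = s - i"
        have k: "s + 1 - (i + 2) = k - 1" "s + 1 - (i + 1) = k" "s + 1 - i = k + 1" "k - 1 \<ge> 1"
          using False i by (auto simp: k_def s_def)
        have o: "k \<in> observed K D" using i by (intro ob) (auto simp: s_def k_def)
        have "r k = H (k - 1) k *v x (k - 1) + H k k *v x k + H (k + 1) k *v x (k + 1)"
          by (simp add: r add_ac)
        from step[OF this S(2)[OF o] low[OF obs1[OF o]] up[OF obs1[OF o]] up[OF obs1[OF o]]]
        show ?thesis unfolding k using k(4) by simp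
      qed
    qed (use that h S cs in auto)
    obtain i where i: "i \<le> D + 2" "j = s + i \<or> j = s + 1 - i"
    proof (cases "j \<ge> s")
      case True
      then show ?thesis using j by (intro that[of "j - s"]) (auto simp: s_def p_def)
    next
      case False
      then show ?thesis using j by (intro that[of "s + 1 - j"]) (auto simp: s_def p_def)
    qed
    then have "norm (x j) \<le> growth h i * S" using left[OF i(1)] right[OF i(1)] i(2) by auto
    also have "\<dots> \<le> g * S" unfolding g_def using i(1) by (intro mult_right_mono growth_mono h S)
    finally show ?thesis .
  qed
  have all: "norm (x j) \<le> g * S" if "j < Q * p" for j
  proof (rule block[of "j div p"])
    have "p > 0" by (simp add: p_def)
    then show "j div p < Q" using that by (simp add: less_mult_imp_div_less)
    show "j \<le> j div p * p + (p - 1)"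
      using mod_less_divisor[OF \<open>p > 0\<close>, of j] div_mult_mod_eq[of j p] by linarith
  qed simp
  have kK: "k \<in> {1..K}" and "k + p \<le> p * Q" using k by (auto simp: dropped_def p_def Q_def)
  \<comment> \<open>All inputs heard by a dropped receiver lie in complete blocks, where
    \<open>all\<close> applies; the clause of \<open>dropped\<close> that spares the last complete
    block guarantees this.\<close>
  then have "k + 1 < Q * p" by (simp add: p_def mult.commute)
  then have "norm (x k) \<le> g * S" "norm (x (k - 1)) \<le> g * S" "norm (x (k + 1)) \<le> g * S"
    by (intro all; simp)+
  moreover have "norm (r k) \<le> h * norm (x k) + h * norm (x (k - 1)) + h * norm (x (k + 1))"
    unfolding r by (intro norm_triangle_mono up kK) auto
  moreover have "h * norm (x j) \<le> h * (g * S)" if "norm (x j) \<le> g * S" for j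
    using h that by (intro mult_left_mono) auto
  ultimately have "norm (r k) \<le> h * (g * S) + h * (g * S) + h * (g * S)" by (meson add_mono order.trans)
  then show ?thesis by (simp add: g_def algebra_simps)
qed

text \<open>Only finitely many matrices concern the first \<open>K\<close> receivers, so a sum of
  all their constants can serve as \<open>h\<close>; it may depend on \<open>K\<close>. The lower
  bound leaves out \<open>k' = 0\<close>, since \<open>H 0 k\<close> need not be invertible.\<close>

lemma channel_bounds:
  fixes H :: "nat \<Rightarrow> nat \<Rightarrow> real ^ ('l::finite) ^ 'l"
  assumes full_rank:
      "\<And>k' k. k \<ge> 1 \<Longrightarrow> k' \<ge> 1 \<Longrightarrow> k' \<in> {k - 1, k, k + 1} \<Longrightarrow> rank (H k' k) = CARD('l)"
  obtains h where "h \<ge> 1"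
    "\<And>k k' v. \<lbrakk>k \<in> {1..K}; k' \<in> {k - 1, k, k + 1}\<rbrakk> \<Longrightarrow> norm (H k' k *v v) \<le> h * norm v"
    "\<And>k k' v. \<lbrakk>k \<in> {1..K}; k' \<in> {k - 1, k, k + 1}; k' \<ge> 1\<rbrakk> \<Longrightarrow> norm v \<le> h * norm (H k' k *v v)"
proof -
  define c where "c k k' = onorm ((*v) (H k' k))" for k k'
  have c: "norm (H k' k *v v) \<le> c k k' * norm v" for k k' v
    unfolding c_def by (rule onorm[OF matrix_vector_mul_bounded_linear])
  have "\<exists>c. k \<ge> 1 \<and> k' \<ge> 1 \<and> k' \<in> {k - 1, k, k + 1} \<longrightarrow> (\<forall>v. norm v \<le> c * norm (H k' k *v v))" for k k'
  proof (cases "k \<ge> 1 \<and> k' \<ge> 1 \<and> k' \<in> {k - 1, k, k + 1}")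
    case True
    then have "inj ((*v) (H k' k))" using full_rank full_rank_injective by blast
    then obtain B where B: "B > 0" "\<And>v. B * norm v \<le> norm (H k' k *v v)"
      using linear_inj_bounded_below_pos[of "(*v) (H k' k)"] by auto
    have "norm v \<le> 1 / B * norm (H k' k *v v)" for v
      using B(1) B(2)[of v] by (simp add: field_simps)
    then show ?thesis by blast
  qed auto
  then obtain d where d: "k \<ge> 1 \<Longrightarrow> k' \<ge> 1 \<Longrightarrow> k' \<in> {k - 1, k, k + 1} \<Longrightarrow> norm v \<le> d k k' * norm (H k' k *v v)" for k k' v
    by metis
  define h where "h = 1 + (\<Sum>(k, k')\<in>{..K} \<times> {..K + 1}. \<bar>c k k'\<bar> + \<bar>d k k'\<bar>)"
  have h: "c k k' \<le> h" "d k k' \<le> h" if "k \<le> K" "k' \<le> K + 1" for k k'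
  proof -
    have "(\<lambda>(k, k'). \<bar>c k k'\<bar> + \<bar>d k k'\<bar>) (k, k') \<le> (\<Sum>(k, k')\<in>{..K} \<times> {..K + 1}. \<bar>c k k'\<bar> + \<bar>d k k'\<bar>)"
      using that by (intro member_le_sum) auto
    then show "c k k' \<le> h" "d k k' \<le> h" by (auto simp: h_def)
  qed
  show ?thesis
  proof (rule that[of h])
    show "h \<ge> 1" unfolding h_def by (auto intro!: sum_nonneg)
    show "norm (H k' k *v v) \<le> h * norm v" if "k \<in> {1..K}" "k' \<in> {k - 1, k, k + 1}" for k k' v
      using c[of k' k v] h(1)[of k k'] that
      by (smt (verit) atLeastAtMost_iff insertE singletonD diff_le_self le_add1 le_trans add_le_mono1 mult_right_mono norm_ge_zero)
    show "norm v \<le> h * norm (H k' k *v v)" if "k \<in> {1..K}" "k' \<in> {k - 1, k, k + 1}" "k' \<ge> 1" for k k' v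
    proof -
      have "norm v \<le> d k k' * norm (H k' k *v v)" using that by (intro d) auto
      also have "\<dots> \<le> h * norm (H k' k *v v)" using that by (intro mult_right_mono h) auto
      finally show ?thesis .
    qed
  qed
qed

text \<open>Information travels one user per round: a message of round \<open>j\<close> comes from a
  neighbour that has itself heard \<open>j - 1\<close> rounds. The observations are the slow
  messages on the transmitter side and the output blocks on the receiver side.\<close>

lemma exchange_local:
  assumes "k \<in> {1..K}" "\<And>k'. \<lbrakk>k' \<in> {1..K}; k' \<le> k + j; k \<le> k' + j\<rbrakk> \<Longrightarrow> obs k' = obs' k'"
  shows "received K j (exchange K \<phi> obs j) k = received K j (exchange K \<phi> obs' j) k"
  using assms
proof (induction j arbitrary: k)
  case 0
  then show ?case by (simp add: received_def)
next
  case (Suc j)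
  have "exchange K \<phi> obs (Suc j) i l k = exchange K \<phi> obs' (Suc j) i l k"
    if i: "i \<in> {1..Suc j}" and l: "l \<in> neighbours K k" for i l
  proof (cases "i = Suc j")
    case True
    have lK: "l \<in> {1..K}" "l \<le> k + 1" "k \<le> l + 1" using l Suc.prems(1) by (auto simp: neighbours_def)
    have "received K j (exchange K \<phi> obs j) l = received K j (exchange K \<phi> obs' j) l"
      using lK by (intro Suc.IH Suc.prems(2)) auto
    moreover have "obs l = obs' l" using lK by (intro Suc.prems(2)) auto
    ultimately show ?thesis using True by simp
  next
    case False
    have "received K j (exchange K \<phi> obs j) k = received K j (exchange K \<phi> obs' j) k"
      using Suc.prems by (intro Suc.IH) auto
    from fun_cong[OF fun_cong[OF this], of i l] show ?thesis
      using False i l by (auto simp: received_def)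
  qed
  then show ?case by (auto simp: received_def fun_eq_iff restrict_def simp del: exchange.simps)
qed

section \<open>Measurability of successful decoding\<close>

text \<open>The restrictions in \<open>received\<close> make the possible receptions a countable set
  of extensional functions. A decoder that is measurable for each fixed reception is then measurable
  after inserting the random one.\<close>

lemma measurable_received:
  assumes "\<And>i l. i \<in> {1..j} \<Longrightarrow> l \<in> neighbours K k \<Longrightarrow> (\<lambda>z. T z i l k) \<in> M \<rightarrow>\<^sub>M count_space UNIV"
  shows "(\<lambda>z. received K j (T z) k) \<in>
    M \<rightarrow>\<^sub>M count_space ({1..j} \<rightarrow>\<^sub>E (neighbours K k \<rightarrow>\<^sub>E UNIV))"
proof -
  have fin: "finite (neighbours K k)" by (simp add: neighbours_def)
  have 1: "count_space (neighbours K k \<rightarrow>\<^sub>E (UNIV :: nat set)) = (\<Pi>\<^sub>M l\<in>neighbours K k. count_space UNIV)"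
    using fin by (intro count_space_PiM_finite[symmetric]) auto
  have 2: "count_space ({1..j} \<rightarrow>\<^sub>E (neighbours K k \<rightarrow>\<^sub>E (UNIV :: nat set))) =
      (\<Pi>\<^sub>M i\<in>{1..j}. count_space (neighbours K k \<rightarrow>\<^sub>E UNIV))"
    using fin by (intro count_space_PiM_finite[symmetric]) (auto intro!: countable_PiE)
  show ?thesis
    unfolding 2 1 received_def by (intro measurable_restrict assms)
qed

lemma countable_received:
  "countable ({1..j :: nat} \<rightarrow>\<^sub>E (neighbours K k \<rightarrow>\<^sub>E (UNIV :: nat set)))"
  by (intro countable_PiE) (auto simp: neighbours_def)

lemma measurable_exchange:
  assumes obs: "\<And>k. k \<in> {1..K} \<Longrightarrow> (\<lambda>z. obs z k) \<in> M \<rightarrow>\<^sub>M B"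
    and \<phi>: "\<And>i k l r. \<lbrakk>k \<in> {1..K}; i \<in> {1..J}; l \<in> neighbours K k\<rbrakk> \<Longrightarrow> (\<lambda>y. \<phi> i k l y r) \<in> B \<rightarrow>\<^sub>M count_space UNIV"
  shows "\<lbrakk>j \<le> J; i \<in> {1..j}; k \<in> {1..K}; l \<in> neighbours K k\<rbrakk> \<Longrightarrow>
    (\<lambda>z. exchange K \<phi> (obs z) j i k l) \<in> M \<rightarrow>\<^sub>M count_space UNIV"
proof (induction j arbitrary: i k l)
  case 0
  then show ?case by simp
next
  case (Suc j)
  show ?case
  proof (cases "i = Suc j")
    case True
    have "(\<lambda>z. received K j (exchange K \<phi> (obs z) j) k)
        \<in> M \<rightarrow>\<^sub>M count_space ({1..j} \<rightarrow>\<^sub>E (neighbours K k \<rightarrow>\<^sub>E UNIV))"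
    proof (intro measurable_received Suc.IH)
      fix l assume "l \<in> neighbours K k"
      then show "l \<in> {1..K}" "k \<in> neighbours K l" using Suc.prems by (auto simp: neighbours_def)
    qed (use Suc.prems in auto)
    moreover have "(\<lambda>z. \<phi> (Suc j) k l (obs z k) r) \<in> M \<rightarrow>\<^sub>M count_space UNIV" for r
      using Suc.prems by (intro measurable_compose[OF obs \<phi>]) auto
    ultimately have "(\<lambda>z. \<phi> (Suc j) k l (obs z k) (received K j (exchange K \<phi> (obs z) j) k))
        \<in> M \<rightarrow>\<^sub>M count_space UNIV"
      by (intro measurable_compose_countable'[OF _ _ countable_received,
            where f = "\<lambda>r z. \<phi> (Suc j) k l (obs z k) r"
              and g = "\<lambda>z. received K j (exchange K \<phi> (obs z) j) k"])
    then show ?thesis using True by simp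
  next
    case False
    then show ?thesis using Suc by auto
  qed
qed

section \<open>Separation of signal and noise, and the event of successful decoding\<close>

lemma channel_input_noise_irrelevant:
  "channel_input K DT C (mF, mS, z) = channel_input K DT C (mF, mS, z')"
  by (intro ext) (simp add: channel_input_def tx_transcript_def fast_message_def slow_message_def)

definition inputs ::
  "nat \<Rightarrow> nat \<Rightarrow> ('l::finite) coding_scheme \<Rightarrow> (nat \<Rightarrow> nat) \<times> (nat \<Rightarrow> nat) \<Rightarrow> nat \<Rightarrow> nat \<Rightarrow> real ^ 'l" where
  "inputs K DT C m = channel_input K DT C (fst m, snd m, \<lambda>_. 0)"

definition signal ::
  "(nat \<Rightarrow> nat \<Rightarrow> real ^ 'l ^ 'l) \<Rightarrow> nat \<Rightarrow> nat \<Rightarrow> ('l::finite) coding_scheme \<Rightarrow>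
   (nat \<Rightarrow> nat) \<times> (nat \<Rightarrow> nat) \<Rightarrow> nat \<Rightarrow> nat \<Rightarrow> real ^ 'l" where
  "signal H K DT C m k t = H k k *v inputs K DT C m k t
      + H (k - 1) k *v inputs K DT C m (k - 1) t + H (k + 1) k *v inputs K DT C m (k + 1) t"

definition noise_space :: "nat \<Rightarrow> nat \<Rightarrow> (nat \<times> nat \<times> 'l \<Rightarrow> real) measure" where
  "noise_space K n = (\<Pi>\<^sub>M i\<in>{1..K} \<times> {1..n} \<times> (UNIV :: 'l set). std_gaussian)"

definition output_of ::
  "(nat \<Rightarrow> nat \<Rightarrow> real ^ 'l ^ 'l) \<Rightarrow> nat \<Rightarrow> nat \<Rightarrow> nat \<Rightarrow> ('l::finite) coding_scheme \<Rightarrow>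
   (nat \<Rightarrow> nat) \<times> (nat \<Rightarrow> nat) \<Rightarrow> (nat \<times> nat \<times> 'l \<Rightarrow> real) \<Rightarrow> nat \<Rightarrow> nat \<Rightarrow> real ^ 'l" where
  "output_of H K n DT C m z = output_block H K n DT C (fst m, snd m, z)"

text \<open>Inputs depend on the messages only, so for fixed \<open>m\<close> the output is a fixed
  vector plus Gaussian noise, the form that \<open>gaussian_packing\<close> treats.\<close>

lemma output_of_eq:
  "output_of H K n DT C m z k = (\<lambda>t\<in>{1..n}. signal H K DT C m k t + (\<chi> i. z (k, t, i)))"
  unfolding output_of_def output_block_def signal_def inputs_def noise_def
  using channel_input_noise_irrelevant[of K DT C "fst m" "snd m" z "\<lambda>_. 0"] by simp

text \<open>A set of noise values and not of outputs, since \<open>gaussian_packing\<close> measures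
  its sets \<open>G m\<close> by the law of the noise.\<close>

definition success ::
  "(nat \<Rightarrow> nat \<Rightarrow> real ^ 'l ^ 'l) \<Rightarrow> nat \<Rightarrow> nat \<Rightarrow> nat \<Rightarrow> nat \<Rightarrow> ('l::finite) coding_scheme \<Rightarrow>
   (nat \<Rightarrow> nat) \<times> (nat \<Rightarrow> nat) \<Rightarrow> (nat \<times> nat \<times> 'l \<Rightarrow> real) set" where
  "success H K n DT DR C m = {z \<in> space (noise_space K n). \<forall>k\<in>{1..K}.
     fast_decoder C k (output_of H K n DT C m z k) = fst m k \<and>
     slow_decoder C k (output_of H K n DT C m z k)
       (received K DR (exchange K (rx_msg C) (output_of H K n DT C m z) DR) k) = snd m k}"

lemma success_iff:
  fixes C :: "('l::finite) coding_scheme"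
  shows "z \<in> success H K n DT DR C (mF, mS) \<longleftrightarrow> z \<in> space (noise_space K n :: (_ \<times> _ \<times> 'l \<Rightarrow> _) measure) \<and>
    (\<forall>k\<in>{1..K}. decoded_fast H K n DT C (mF, mS, z) k = fast_message (mF, mS, z) k \<and>
       decoded_slow H K n DT DR C (mF, mS, z) k = slow_message (mF, mS, z) k)"
  by (auto simp: success_def decoded_fast_def decoded_slow_def rx_transcript_def output_of_def
      fast_message_def slow_message_def)

lemma measurable_output_of:
  fixes C :: "('l::finite) coding_scheme"
  assumes "k \<in> {1..K}"
  shows "(\<lambda>z. output_of H K n DT C m z k) \<in> (noise_space K n :: (_ \<times> _ \<times> 'l \<Rightarrow> _) measure) \<rightarrow>\<^sub>M (\<Pi>\<^sub>M t\<in>{1..n}. borel)"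
  unfolding output_of_eq
proof (intro measurable_restrict borel_measurable_add borel_measurable_const)
  fix t assume t: "t \<in> {1..n}"
  show "(\<lambda>z. \<chi> i. z (k, t, i)) \<in> borel_measurable (noise_space K n :: (_ \<times> _ \<times> 'l \<Rightarrow> _) measure)"
  proof (subst borel_measurable_euclidean_space, clarify)
    fix b :: "real ^ 'l" assume "b \<in> Basis"
    then obtain i where "b = axis i 1" by (auto simp: Basis_vec_def)
    moreover have "(\<lambda>z. z (k, t, i)) \<in> (noise_space K n :: (_ \<times> _ \<times> 'l \<Rightarrow> _) measure) \<rightarrow>\<^sub>M std_gaussian"
      unfolding noise_space_def using t assms by (intro measurable_component_singleton) auto
    then have "(\<lambda>z. z (k, t, i)) \<in> borel_measurable (noise_space K n :: (_ \<times> _ \<times> 'l \<Rightarrow> _) measure)"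
      by (simp cong: measurable_cong_sets)
    ultimately show "(\<lambda>z. (\<chi> i. z (k, t, i)) \<bullet> b) \<in> borel_measurable (noise_space K n :: (_ \<times> _ \<times> 'l \<Rightarrow> _) measure)"
      by (simp add: inner_axis)
  qed
qed

lemma success_sets:
  fixes C :: "('l::finite) coding_scheme"
  assumes "measurable_receivers K n DR C"
  shows "success H K n DT DR C m \<in> sets (noise_space K n)"
proof -
  let ?N = "noise_space K n :: (nat \<times> nat \<times> 'l \<Rightarrow> real) measure"
  let ?B = "\<Pi>\<^sub>M t\<in>{1..n}. (borel :: (real ^ 'l) measure)"
  note meas = assms[unfolded measurable_receivers_def Let_def, rule_format]
  have out: "(\<lambda>z. output_of H K n DT C m z k) \<in> ?N \<rightarrow>\<^sub>M ?B" if "k \<in> {1..K}" for k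
    using that by (rule measurable_output_of)
  have 1: "(\<lambda>z. fast_decoder C k (output_of H K n DT C m z k)) \<in> ?N \<rightarrow>\<^sub>M count_space UNIV"
    if "k \<in> {1..K}" for k
    using meas[OF that] by (intro measurable_compose[OF out[OF that]]) blast
  have 2: "(\<lambda>z. slow_decoder C k (output_of H K n DT C m z k)
       (received K DR (exchange K (rx_msg C) (output_of H K n DT C m z) DR) k)) \<in> ?N \<rightarrow>\<^sub>M count_space UNIV"
    if k: "k \<in> {1..K}" for k
  proof (rule measurable_compose_countable'[where I = "{1..DR} \<rightarrow>\<^sub>E (neighbours K k \<rightarrow>\<^sub>E UNIV)"
        and f = "\<lambda>r z. slow_decoder C k (output_of H K n DT C m z k) r"
        and g = "\<lambda>z. received K DR (exchange K (rx_msg C) (output_of H K n DT C m z) DR) k"])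
    show "(\<lambda>z. slow_decoder C k (output_of H K n DT C m z k) r) \<in> ?N \<rightarrow>\<^sub>M count_space UNIV" for r
      using meas[OF k] by (intro measurable_compose[OF out[OF k]]) blast
    show "(\<lambda>z. received K DR (exchange K (rx_msg C) (output_of H K n DT C m z) DR) k)
        \<in> ?N \<rightarrow>\<^sub>M count_space ({1..DR} \<rightarrow>\<^sub>E (neighbours K k \<rightarrow>\<^sub>E UNIV))"
    proof (intro measurable_received measurable_exchange[where J = DR and B = ?B])
      fix l assume "l \<in> neighbours K k"
      then show "l \<in> {1..K}" "k \<in> neighbours K l" using k by (auto simp: neighbours_def)
    qed (use out meas in auto)
  qed (rule countable_received)
  have eq: "{z \<in> space ?N. f z = (c :: nat)} \<in> sets ?N" if "f \<in> ?N \<rightarrow>\<^sub>M count_space UNIV" for f c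
    using measurable_sets[OF that, of "{c}"] by (simp add: vimage_def Int_def conj_commute)
  show ?thesis
    unfolding success_def
    by (intro sets.sets_Collect_finite_All sets.sets_Collect_conj eq[OF 1] eq[OF 2]) simp_all
qed

section \<open>Averaging over the messages\<close>

definition messages :: "nat \<Rightarrow> nat \<Rightarrow> (nat \<Rightarrow> real) \<Rightarrow> (nat \<Rightarrow> nat) set" where
  "messages K n R = (\<Pi>\<^sub>E k\<in>{1..K}. message_set n (R k))"

abbreviation message_law :: "nat \<Rightarrow> nat \<Rightarrow> (nat \<Rightarrow> real) \<Rightarrow> (nat \<Rightarrow> nat) measure" where
  "message_law K n R \<equiv> (\<Pi>\<^sub>M k\<in>{1..K}. uniform_count_measure (message_set n (R k)))"

lemma card_message_set: "card (message_set n R) = nat \<lfloor>2 powr (real n * R)\<rfloor>"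
  by (simp add: message_set_def)

lemma card_message_set_pos: "R \<ge> 0 \<Longrightarrow> 0 < card (message_set n R)"
  by (simp add: card_message_set ge_one_powr_ge_zero)

lemma finite_message_set [simp]: "finite (message_set n R)"
  by (simp add: message_set_def)

lemma finite_messages [simp]: "finite (messages K n R)"
  unfolding messages_def by (intro finite_PiE) auto

lemma card_messages: "card (messages K n R) = (\<Prod>k\<in>{1..K}. card (message_set n (R k)))"
  unfolding messages_def by (rule card_PiE) simp

lemma space_message_law: "space (message_law K n R) = messages K n R"
  by (simp add: space_PiM messages_def space_uniform_count_measure)

context
  fixes K n :: nat and R :: "nat \<Rightarrow> real"
  assumes R: "\<And>k. k \<in> {1..K} \<Longrightarrow> 0 \<le> R k"
begin

lemma card_messages_pos: "0 < card (messages K n R)"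
  using R by (simp add: card_messages card_message_set_pos prod_pos)

lemma prob_space_message_law: "prob_space (message_law K n R)"
proof -
  define U where "U k = (if k \<in> {1..K} then uniform_count_measure (message_set n (R k)) else uniform_count_measure {0})" for k
  have "prob_space (U k)" for k
    unfolding U_def using R card_message_set_pos[of "R k" n]
    by (auto intro!: prob_space_uniform_count_measure simp: card_gt_0_iff)
  then have "prob_space (\<Pi>\<^sub>M k\<in>{1..K}. U k)" by (intro prob_space_PiM)
  moreover have "(\<Pi>\<^sub>M k\<in>{1..K}. U k) = message_law K n R"
    by (intro PiM_cong) (auto simp: U_def)
  ultimately show ?thesis by simp
qed

lemma message_atom:
  assumes "m \<in> messages K n R"
  shows "{m} \<in> sets (message_law K n R)"
    and "emeasure (message_law K n R) {m} = ennreal (1 / card (messages K n R))"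
proof -
  \<comment> \<open>The locale \<open>product_prob_space\<close> asks for a probability measure at
    every index. Outside \<open>{1..K}\<close> the rate may be negative and the message set empty;
    the one-point measure placed there does not affect the product.\<close>
  define U where "U k = (if k \<in> {1..K} then uniform_count_measure (message_set n (R k)) else uniform_count_measure {0})" for k
  have "prob_space (U k)" for k
    unfolding U_def using R card_message_set_pos[of "R k" n]
    by (auto intro!: prob_space_uniform_count_measure simp: card_gt_0_iff)
  then interpret product_prob_space U "{1..K}" by (simp add: product_prob_space_def product_prob_space_axioms_def product_sigma_finite_def prob_space_imp_sigma_finite)
  have eq: "(\<Pi>\<^sub>M k\<in>{1..K}. U k) = message_law K n R"
    by (intro PiM_cong) (auto simp: U_def)
  have m: "m \<in> extensional {1..K}" "\<And>k. k \<in> {1..K} \<Longrightarrow> m k \<in> message_set n (R k)"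
    using assms by (auto simp: messages_def PiE_def)
  have sing: "{m} = (\<Pi>\<^sub>E k\<in>{1..K}. {m k})" using m(1) by (simp add: PiE_singleton)
  have s: "{m k} \<in> sets (U k)" if "k \<in> {1..K}" for k
    using that m(2) by (auto simp: U_def sets_uniform_count_measure)
  have "(\<Pi>\<^sub>E k\<in>{1..K}. {m k}) \<in> sets (\<Pi>\<^sub>M k\<in>{1..K}. U k)" by (intro sets_PiM_I_finite s) auto
  then show "{m} \<in> sets (message_law K n R)" unfolding eq sing[symmetric] .
  have "emeasure (\<Pi>\<^sub>M k\<in>{1..K}. U k) (\<Pi>\<^sub>E k\<in>{1..K}. {m k}) = (\<Prod>k\<in>{1..K}. emeasure (U k) {m k})"
    by (intro emeasure_PiM s) auto
  also have "\<dots> = (\<Prod>k\<in>{1..K}. ennreal (1 / card (message_set n (R k))))"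
    using m(2) by (intro prod.cong refl) (simp add: U_def emeasure_uniform_count_measure)
  also have "\<dots> = ennreal (1 / card (messages K n R))"
    by (simp add: prod_ennreal card_messages prod_dividef)
  finally show "emeasure (message_law K n R) {m} = ennreal (1 / card (messages K n R))"
    unfolding eq sing[symmetric] .
qed

end

lemma prob_space_noise_space: "prob_space (noise_space K n)"
  unfolding noise_space_def by (intro prob_space_PiM prob_space_std_gaussian)

lemma sample_space_eq:
  "sample_space K n RF RS = message_law K n RF \<Otimes>\<^sub>M (message_law K n RS \<Otimes>\<^sub>M noise_space K n)"
  by (simp add: sample_space_def noise_space_def)

context
  fixes K n :: nat and RF RS :: "nat \<Rightarrow> real"
  assumes RF: "\<And>k. k \<in> {1..K} \<Longrightarrow> 0 \<le> RF k" and RS: "\<And>k. k \<in> {1..K} \<Longrightarrow> 0 \<le> RS k"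
begin

lemma prob_space_sample_space: "prob_space (sample_space K n RF RS)"
proof -
  interpret F: prob_space "message_law K n RF" using RF by (rule prob_space_message_law)
  interpret S: prob_space "message_law K n RS" using RS by (rule prob_space_message_law)
  interpret N: prob_space "noise_space K n" by (rule prob_space_noise_space)
  interpret SN: pair_prob_space "message_law K n RS" "noise_space K n" ..
  interpret FSN: pair_prob_space "message_law K n RF" "message_law K n RS \<Otimes>\<^sub>M noise_space K n" ..
  show ?thesis unfolding sample_space_eq by (rule FSN.prob_space_axioms)
qed

lemma emeasure_sample_slice:
  fixes G :: "(nat \<times> nat \<times> ('l::finite) \<Rightarrow> real) set"
  assumes "mF \<in> messages K n RF" "mS \<in> messages K n RS" "G \<in> sets (noise_space K n)"
  shows "{mF} \<times> {mS} \<times> G \<in> sets (sample_space K n RF RS)"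
    and "emeasure (sample_space K n RF RS) ({mF} \<times> {mS} \<times> G) =
      ennreal (1 / (card (messages K n RF) * card (messages K n RS))) * emeasure (noise_space K n) G"
proof -
  let ?N = "noise_space K n :: (nat \<times> nat \<times> 'l \<Rightarrow> real) measure"
  interpret F: prob_space "message_law K n RF" using RF by (rule prob_space_message_law)
  interpret S: prob_space "message_law K n RS" using RS by (rule prob_space_message_law)
  interpret N: prob_space ?N by (rule prob_space_noise_space)
  interpret SN: pair_prob_space "message_law K n RS" ?N ..
  note aF = message_atom[OF RF assms(1)] and aS = message_atom[OF RS assms(2)]
  show "{mF} \<times> {mS} \<times> G \<in> sets (sample_space K n RF RS)"
    unfolding sample_space_eq by (intro pair_measureI aF(1) aS(1) assms(3))
  have "emeasure (sample_space K n RF RS) ({mF} \<times> {mS} \<times> G) =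
     ennreal (1 / card (messages K n RF)) * (ennreal (1 / card (messages K n RS)) * emeasure ?N G)"
    unfolding sample_space_eq
    using aF aS assms(3)
    by (subst SN.emeasure_pair_measure_Times) (auto simp: N.emeasure_pair_measure_Times)
  then show "emeasure (sample_space K n RF RS) ({mF} \<times> {mS} \<times> G) =
      ennreal (1 / (card (messages K n RF) * card (messages K n RS))) * emeasure ?N G"
    by (simp flip: mult.assoc ennreal_mult)
qed

text \<open>The sample space splits into slices of equal weight, one for each pair of messages, and
  the complement of the error event is the disjoint union of their success parts. This converts the
  error probability into the sum that packing bounds from above.\<close>

lemma sum_success:
  fixes C :: "('l::finite) coding_scheme"
  assumes C: "measurable_receivers K n DR C"
  shows "(\<Sum>m\<in>messages K n RF \<times> messages K n RS. measure (noise_space K n) (success H K n DT DR C m)) =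
    (1 - error_prob H K n DT DR RF RS C) * (card (messages K n RF) * card (messages K n RS))"
proof -
  let ?N = "noise_space K n :: (nat \<times> nat \<times> 'l \<Rightarrow> real) measure"
  let ?M = "sample_space K n RF RS :: 'l sample measure"
  interpret M: prob_space ?M by (rule prob_space_sample_space)
  interpret N: prob_space ?N by (rule prob_space_noise_space)
  define FS where "FS = messages K n RF \<times> messages K n RS"
  define c where "c = real (card (messages K n RF) * card (messages K n RS))"
  have c: "c > 0" using card_messages_pos[OF RF] card_messages_pos[OF RS] by (simp add: c_def)
  define U where "U m = {fst m} \<times> {snd m} \<times> success H K n DT DR C m" for m
  have Us: "U m \<in> sets ?M" if "m \<in> FS" for m
    unfolding U_def using that by (intro emeasure_sample_slice success_sets C) (auto simp: FS_def)
  have Um: "measure ?M (U m) = measure ?N (success H K n DT DR C m) / c" if "m \<in> FS" for m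
  proof -
    have "emeasure ?M (U m) = ennreal (1 / c) * emeasure ?N (success H K n DT DR C m)"
      unfolding U_def c_def using that
      by (subst emeasure_sample_slice(2)) (auto simp: FS_def intro!: success_sets C)
    then show ?thesis using c
      by (simp add: M.emeasure_eq_measure N.emeasure_eq_measure flip: ennreal_mult)
  qed
  have sp: "space ?M = messages K n RF \<times> messages K n RS \<times> space ?N"
    unfolding sample_space_eq space_pair_measure space_message_law ..
  have "error_prob H K n DT DR RF RS C = measure ?M (space ?M - (\<Union>m\<in>FS. U m))"
    unfolding error_prob_def Let_def sp
  proof (intro arg_cong[where f = "measure ?M"] set_eqI iffI; clarify)
    fix mF mS z assume *: "(mF, mS, z) \<notin> (\<Union>m\<in>FS. U m)" "mF \<in> messages K n RF" "mS \<in> messages K n RS" "z \<in> space ?N"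
    then have "(mF, mS) \<in> FS" by (simp add: FS_def)
    then have "z \<notin> success H K n DT DR C (mF, mS)" using *(1) by (force simp: U_def)
    then show "(mF, mS, z) \<in> messages K n RF \<times> messages K n RS \<times> space ?N \<and>
      (\<exists>k\<in>{1..K}. decoded_fast H K n DT C (mF, mS, z) k \<noteq> fast_message (mF, mS, z) k \<or>
         decoded_slow H K n DT DR C (mF, mS, z) k \<noteq> slow_message (mF, mS, z) k)"
      using * by (auto simp: success_iff)
  qed (auto simp: U_def success_iff)
  also have "\<dots> = 1 - measure ?M (\<Union>m\<in>FS. U m)"
    using Us by (intro M.prob_compl sets.finite_UN) (auto simp: FS_def)
  also have "measure ?M (\<Union>m\<in>FS. U m) = (\<Sum>m\<in>FS. measure ?M (U m))"
    using Us by (intro M.finite_measure_finite_Union) (auto simp: FS_def disjoint_family_on_def U_def)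
  also have "\<dots> = (\<Sum>m\<in>FS. measure ?N (success H K n DT DR C m)) / c"
    by (simp add: Um sum_divide_distrib)
  finally show ?thesis using c unfolding FS_def[symmetric] c_def[symmetric] by (simp add: field_simps)
qed

text \<open>Each pair of messages has positive probability and the inputs do not depend on the
  noise, so an almost sure constraint cannot fail at any pair. Packing needs the energy bound for
  every single \<open>m\<close>.\<close>

lemma power_constraint_everywhere:
  fixes C :: "('l::finite) coding_scheme"
  assumes AE: "AE \<omega> in (sample_space K n RF RS :: 'l sample measure).
      (1 / real n) * (\<Sum>t=1..n. (norm (channel_input K DT C \<omega> k t))\<^sup>2) \<le> P"
    and m: "m \<in> messages K n RF \<times> messages K n RS"
  shows "(1 / real n) * (\<Sum>t=1..n. (norm (inputs K DT C m k t))\<^sup>2) \<le> P"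
proof (rule ccontr)
  let ?N = "noise_space K n :: (nat \<times> nat \<times> 'l \<Rightarrow> real) measure"
  let ?M = "sample_space K n RF RS :: 'l sample measure"
  interpret N: prob_space ?N by (rule prob_space_noise_space)
  assume neg: "\<not> ?thesis"
  obtain mF mS where mm: "m = (mF, mS)" by (cases m)
  have X: "channel_input K DT C (mF, mS, z) = inputs K DT C m" for z
    using channel_input_noise_irrelevant[of K DT C mF mS z "\<lambda>_. 0"] by (simp add: inputs_def mm)
  let ?A = "{mF} \<times> {mS} \<times> space ?N"
  have A: "?A \<in> sets ?M" "emeasure ?M ?A =
      ennreal (1 / (card (messages K n RF) * card (messages K n RS))) * emeasure ?N (space ?N)"
    using m mm by (intro emeasure_sample_slice; auto)+
  obtain Z where Z: "{\<omega> \<in> space ?M. \<not> (1 / real n) * (\<Sum>t=1..n. (norm (channel_input K DT C \<omega> k t))\<^sup>2) \<le> P} \<subseteq> Z"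
      "emeasure ?M Z = 0" "Z \<in> sets ?M"
    using AE by (rule AE_E)
  have "?A \<subseteq> Z"
  proof
    fix \<omega> assume \<omega>: "\<omega> \<in> ?A"
    then have "\<omega> \<in> space ?M" using A(1) sets.sets_into_space by blast
    moreover have "channel_input K DT C \<omega> = inputs K DT C m" using \<omega> X by auto
    ultimately show "\<omega> \<in> Z" using neg Z(1) by auto
  qed
  then have "emeasure ?M ?A \<le> 0" using emeasure_mono[OF _ Z(3)] Z(2) by metis
  moreover have "0 < real (card (messages K n RF)) * real (card (messages K n RS))"
    using card_messages_pos[OF RF] card_messages_pos[OF RS] by simp
  ultimately show False using A(2) by (auto simp: N.emeasure_space_1 zero_less_mult_iff card_gt_0_iff)
qed

end

section \<open>Packing bounds for the network\<close>

lemma sum_square_components: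
  fixes f :: "'a \<Rightarrow> 'b \<Rightarrow> real ^ ('l::finite)"
  shows "(\<Sum>(k, t, i)\<in>A \<times> T \<times> UNIV. (f k t $ i)\<^sup>2) = (\<Sum>k\<in>A. \<Sum>t\<in>T. (norm (f k t))\<^sup>2)"
proof -
  have "(norm v)\<^sup>2 = (\<Sum>i\<in>UNIV. (v $ i)\<^sup>2)" for v :: "real ^ 'l"
    by (simp add: norm_vec_def L2_set_def sum_nonneg)
  then show ?thesis by (simp add: sum.cartesian_product)
qed

lemma norm_sum3_square_le:
  fixes u v w :: "'a::real_normed_vector"
  shows "(norm (u + v + w))\<^sup>2 \<le> 3 * ((norm u)\<^sup>2 + (norm v)\<^sup>2 + (norm w)\<^sup>2)"
proof -
  have "(norm (u + v + w))\<^sup>2 \<le> (norm u + norm v + norm w)\<^sup>2"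
    by (intro power_mono norm_triangle_mono) auto
  also have "\<dots> \<le> 3 * ((norm u)\<^sup>2 + (norm v)\<^sup>2 + (norm w)\<^sup>2)"
    using zero_le_power2[of "norm u - norm v"] zero_le_power2[of "norm v - norm w"]
      zero_le_power2[of "norm u - norm w"]
    by (simp add: power2_eq_square algebra_simps)
  finally show ?thesis .
qed

text \<open>\<open>K\<close> bounds the number of dropped receivers, the square turns the norm
  estimate of \<open>dropped_coercive\<close> into one for energies, and the summand 1 secures the
  condition \<open>C \<ge> 1\<close> of \<open>gaussian_packing\<close>.\<close>

definition coarse_constant :: "real \<Rightarrow> nat \<Rightarrow> nat \<Rightarrow> real" where
  "coarse_constant h K D = 1 + real K * (3 * h * growth h (D + 2))\<^sup>2"

text \<open>The \<open>n\<close>-th root of the bound in \<open>gaussian_packing\<close> for the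
  choice \<open>a = P\<close>. The energy \<open>E\<close> is
  \<open>9 * h\<^sup>2 * K * n * P\<close>, so \<open>E / (4 * a)\<close> is linear in
  \<open>n\<close> and free of \<open>P\<close>; only the first factor grows with
  \<open>P\<close>.\<close>

definition packing_base :: "real \<Rightarrow> nat \<Rightarrow> nat \<Rightarrow> nat \<Rightarrow> real \<Rightarrow> real" where
  "packing_base h L K D P =
     sqrt (2 * (1 + P)) ^ (L * card (observed K D)) *
     sqrt (16 * coarse_constant h K D) ^ (L * card (dropped K D)) * exp (9 * h\<^sup>2 * real K / 4)"

text \<open>The centres have positions \<open>D + 1\<close> and \<open>D + 2\<close> in their block.
  Moving \<open>D\<close> users either way leads at most to positions 1 and
  \<open>2 * D + 2\<close>, the first and the last that are always observed.\<close>

lemma centre_block: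
  assumes "k \<in> centres K D" "k' \<in> {1..K}" "k' \<le> k + D" "k \<le> k' + D"
  shows "k' \<in> observed K D"
proof -
  obtain q where "q < K div (2 * D + 4)" "k = q * (2 * D + 4) + D + 1 \<or> k = q * (2 * D + 4) + D + 2"
    using assms(1) by (auto simp: centres_def)
  then show ?thesis using assms(3,4) by (intro block_observed[of q]) auto
qed

lemma centre_user:
  assumes "k \<in> centres K D"
  shows "k \<in> {1..K}"
proof -
  obtain q where "q < K div (2 * D + 4)" "k = q * (2 * D + 4) + D + 1 \<or> k = q * (2 * D + 4) + D + 2"
    using assms by (auto simp: centres_def)
  then have "k \<in> observed K D" by (intro block_observed[of q]) auto
  then show ?thesis by (simp add: observed_def)
qed

lemma inputs_eqI:
  assumes k: "k \<in> {1..K}" and fst: "fst m k = fst m' k"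
    and snd: "\<And>k'. \<lbrakk>k' \<in> {1..K}; k' \<le> k + DT; k \<le> k' + DT\<rbrakk> \<Longrightarrow> snd m k' = snd m' k'"
  shows "inputs K DT C m k = inputs K DT C m' k"
proof -
  have "received K DT (exchange K (tx_msg C) (snd m) DT) k = received K DT (exchange K (tx_msg C) (snd m') DT) k"
    using k snd by (rule exchange_local)
  moreover have "snd m k = snd m' k" using k by (intro snd) auto
  ultimately show ?thesis using k fst
    by (intro ext) (simp add: inputs_def channel_input_def tx_transcript_def fast_message_def slow_message_def)
qed

lemma inputs_outside [simp]: "k \<notin> {1..K} \<Longrightarrow> inputs K DT C m k = (\<lambda>t. 0)"
  by (auto simp: inputs_def channel_input_def)

text \<open>\<open>h\<close> bounds the channel matrices and their inverses; the estimates below may depend on it since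
  \<open>K\<close> and the channel are fixed while \<open>n\<close> and then \<open>P\<close> tend to infinity.\<close>

locale wyner_network =
  fixes H :: "nat \<Rightarrow> nat \<Rightarrow> real ^ ('l::finite) ^ 'l" and K :: nat and h :: real
  assumes h: "h \<ge> 1"
    and up: "\<And>k k' v. \<lbrakk>k \<in> {1..K}; k' \<in> {k - 1, k, k + 1}\<rbrakk> \<Longrightarrow> norm (H k' k *v v) \<le> h * norm v"
    and low: "\<And>k k' v. \<lbrakk>k \<in> {1..K}; k' \<in> {k - 1, k, k + 1}; k' \<ge> 1\<rbrakk> \<Longrightarrow> norm v \<le> h * norm (H k' k *v v)"
begin

text \<open>9 is 3 times 3: one factor for the square of a sum of three terms, one for three inputs
  of energy at most \<open>n * P\<close> each. Missing neighbours at the ends of the line send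
  0.\<close>

lemma signal_energy:
  assumes k: "k \<in> {1..K}" and P: "0 \<le> P" and n: "1 \<le> n"
    and power: "\<And>k. k \<in> {1..K} \<Longrightarrow> (1 / real n) * (\<Sum>t=1..n. (norm (inputs K DT C m k t))\<^sup>2) \<le> P"
  shows "(\<Sum>t=1..n. (norm (signal H K DT C m k t))\<^sup>2) \<le> 9 * h\<^sup>2 * real n * P"
proof -
  have E: "(\<Sum>t=1..n. (norm (inputs K DT C m j t))\<^sup>2) \<le> real n * P" for j
  proof (cases "j \<in> {1..K}")
    case True
    from power[OF this] n show ?thesis by (simp add: field_simps)
  next
    case False
    then show ?thesis using P by simp
  qed
  have "(norm (signal H K DT C m k t))\<^sup>2 \<le> 3 * h\<^sup>2 * ((norm (inputs K DT C m k t))\<^sup>2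
      + (norm (inputs K DT C m (k - 1) t))\<^sup>2 + (norm (inputs K DT C m (k + 1) t))\<^sup>2)" for t
  proof -
    have sq: "(norm (H k' k *v v))\<^sup>2 \<le> h\<^sup>2 * (norm v)\<^sup>2" if "k' \<in> {k - 1, k, k + 1}" for k' v
      using power_mono[OF up[OF k that], of v 2] by (simp add: power_mult_distrib)
    have "(norm (signal H K DT C m k t))\<^sup>2 \<le> 3 * (h\<^sup>2 * (norm (inputs K DT C m k t))\<^sup>2
      + h\<^sup>2 * (norm (inputs K DT C m (k - 1) t))\<^sup>2 + h\<^sup>2 * (norm (inputs K DT C m (k + 1) t))\<^sup>2)"
      unfolding signal_def
      by (rule order.trans[OF norm_sum3_square_le]) (intro mult_left_mono add_mono sq; simp)
    then show ?thesis by (simp add: algebra_simps)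
  qed
  then have "(\<Sum>t=1..n. (norm (signal H K DT C m k t))\<^sup>2) \<le> (\<Sum>t=1..n. 3 * h\<^sup>2 * ((norm (inputs K DT C m k t))\<^sup>2
      + (norm (inputs K DT C m (k - 1) t))\<^sup>2 + (norm (inputs K DT C m (k + 1) t))\<^sup>2))"
    by (intro sum_mono)
  also have "\<dots> = 3 * h\<^sup>2 * ((\<Sum>t=1..n. (norm (inputs K DT C m k t))\<^sup>2)
      + (\<Sum>t=1..n. (norm (inputs K DT C m (k - 1) t))\<^sup>2) + (\<Sum>t=1..n. (norm (inputs K DT C m (k + 1) t))\<^sup>2))"
    by (simp add: sum.distrib flip: sum_distrib_left)
  also have "\<dots> \<le> 3 * h\<^sup>2 * (real n * P + real n * P + real n * P)"
    by (intro mult_left_mono add_mono E) auto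
  finally show ?thesis by (simp add: algebra_simps)
qed

text \<open>By linearity the difference of two signals is the channel response to the difference of
  the inputs, which vanishes at the centres. The square root of the observed energy serves as the
  common bound \<open>S\<close> in \<open>dropped_coercive\<close>.\<close>

lemma signal_coercive:
  assumes "\<And>k. k \<in> centres K D \<Longrightarrow> inputs K DT C m k = inputs K DT C m' k"
  shows "(\<Sum>k\<in>dropped K D. (norm (signal H K DT C m k t - signal H K DT C m' k t))\<^sup>2) \<le>
    coarse_constant h K D * (\<Sum>k\<in>observed K D. (norm (signal H K DT C m k t - signal H K DT C m' k t))\<^sup>2)"
proof -
  define r where "r k = signal H K DT C m k t - signal H K DT C m' k t" for k
  define x where "x k = inputs K DT C m k t - inputs K DT C m' k t" for k
  define T where "T = (\<Sum>k\<in>observed K D. (norm (r k))\<^sup>2)"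
  define c where "c = 3 * h * growth h (D + 2)"
  have T: "T \<ge> 0" by (simp add: T_def sum_nonneg)
  have c: "c \<ge> 0" using h growth_nonneg[of h] by (simp add: c_def)
  have rx: "r k = H k k *v x k + H (k - 1) k *v x (k - 1) + H (k + 1) k *v x (k + 1)" for k
    by (simp add: r_def x_def signal_def matrix_vector_mult_diff_distrib)
  have obs: "norm (r k) \<le> sqrt T" if "k \<in> observed K D" for k
    unfolding T_def using that by (intro real_le_rsqrt member_le_sum[where f = "\<lambda>k. (norm (r k))\<^sup>2"]) auto
  have "(norm (r k))\<^sup>2 \<le> c\<^sup>2 * T" if k: "k \<in> dropped K D" for k
  proof -
    have "norm (r k) \<le> c * sqrt T"
      unfolding c_def using T obs assms
      by (intro dropped_coercive[OF h up low _ _ rx _ _ k]) (auto simp: x_def)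
    then have "(norm (r k))\<^sup>2 \<le> (c * sqrt T)\<^sup>2" by (intro power_mono) auto
    then show ?thesis using T by (simp add: power_mult_distrib)
  qed
  then have "(\<Sum>k\<in>dropped K D. (norm (r k))\<^sup>2) \<le> real (card (dropped K D)) * (c\<^sup>2 * T)"
    by (rule sum_bounded_above)
  also have "card (dropped K D) \<le> card {1..K}" by (intro card_mono) (auto simp: dropped_def)
  then have "real (card (dropped K D)) * (c\<^sup>2 * T) \<le> real K * (c\<^sup>2 * T)"
    using T by (intro mult_right_mono) auto
  also have "\<dots> \<le> coarse_constant h K D * T"
    using T by (simp add: coarse_constant_def c_def algebra_simps)
  finally show ?thesis by (simp add: r_def T_def)
qed

text \<open>Stated for any set \<open>W\<close> of message pairs so that the slow messages can be
  frozen. The hypothesis \<open>centre\<close> isolates the decoding argument, which differs between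
  the bound on the sum and the bound on the fast rate.\<close>

lemma network_packing:
  fixes C :: "'l coding_scheme"
  assumes P: "0 < P" and n: "1 \<le> n" and W: "W \<subseteq> messages K n RF \<times> messages K n RS"
    and meas: "measurable_receivers K n DR C"
    and power: "\<And>m k. \<lbrakk>m \<in> W; k \<in> {1..K}\<rbrakk> \<Longrightarrow> (1 / real n) * (\<Sum>t=1..n. (norm (inputs K DT C m k t))\<^sup>2) \<le> P"
    and centre: "\<And>m m' z z' k. \<lbrakk>m \<in> W; m' \<in> W; z \<in> success H K n DT DR C m; z' \<in> success H K n DT DR C m';
        \<And>k. k \<in> observed K D \<Longrightarrow> output_of H K n DT C m z k = output_of H K n DT C m' z' k; k \<in> centres K D\<rbrakk>
        \<Longrightarrow> inputs K DT C m k = inputs K DT C m' k"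
  shows "(\<Sum>m\<in>W. measure (noise_space K n) (success H K n DT DR C m)) \<le> packing_base h CARD('l) K D P ^ n"
proof -
  define IA where "IA = observed K D \<times> {1..n} \<times> (UNIV :: 'l set)"
  define IB where "IB = dropped K D \<times> {1..n} \<times> (UNIV :: 'l set)"
  define x where "x m = (\<lambda>(k, t, i). signal H K DT C m k t $ i)" for m
  have I: "IA \<union> IB = {1..K} \<times> {1..n} \<times> (UNIV :: 'l set)"
    unfolding IA_def IB_def observed_Un_dropped[of K D, symmetric] by auto
  have out: "output_of H K n DT C m z k = output_of H K n DT C m' z' k"
    if "\<And>i. i \<in> J \<Longrightarrow> x m i + z i = x m' i + z' i" "{k} \<times> {1..n} \<times> UNIV \<subseteq> J" for J m m' z z' k
    unfolding output_of_eq
  proof (intro restrict_ext)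
    fix t assume "t \<in> {1..n}"
    then have "x m (k, t, i) + z (k, t, i) = x m' (k, t, i) + z' (k, t, i)" for i
      using that by blast
    then show "signal H K DT C m k t + (\<chi> i. z (k, t, i)) = signal H K DT C m' k t + (\<chi> i. z' (k, t, i))"
      by (simp add: x_def vec_eq_iff)
  qed
  have cc: "coarse_constant h K D \<ge> 1" by (simp add: coarse_constant_def)
  have "(\<Sum>m\<in>W. measure (\<Pi>\<^sub>M i\<in>IA \<union> IB. std_gaussian) (success H K n DT DR C m)) \<le>
     sqrt (2 * (1 + P)) ^ card IA * sqrt (16 * coarse_constant h K D) ^ card IB * exp (9 * h\<^sup>2 * real K * real n * P / (4 * P))"
  proof (rule gaussian_packing[where x = x])
    show "finite IA" "finite IB" by (auto simp: IA_def IB_def)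
    show "IA \<inter> IB = {}" using observed_Int_dropped[of K D] by (auto simp: IA_def IB_def)
    show "finite W" using W by (rule finite_subset) auto
    show "success H K n DT DR C m \<in> sets (\<Pi>\<^sub>M i\<in>IA \<union> IB. std_gaussian)" for m
      using success_sets[OF meas] unfolding I noise_space_def by blast
    show "m = m'" if *: "m \<in> W" "m' \<in> W" "z \<in> success H K n DT DR C m" "z' \<in> success H K n DT DR C m'"
      "\<And>i. i \<in> IA \<union> IB \<Longrightarrow> x m i + z i = x m' i + z' i" for m m' z z'
    proof -
      have o: "output_of H K n DT C m z k = output_of H K n DT C m' z' k" if "k \<in> {1..K}" for k
        using *(5) by (rule out) (use that in \<open>auto simp: I\<close>)
      have r: "received K DR (exchange K (rx_msg C) (output_of H K n DT C m z) DR) k =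
          received K DR (exchange K (rx_msg C) (output_of H K n DT C m' z') DR) k" if "k \<in> {1..K}" for k
        using that by (rule exchange_local) (rule o)
      have eq: "fst m k = fst m' k \<and> snd m k = snd m' k" if k: "k \<in> {1..K}" for k
        using *(3,4) k o[OF k] r[OF k] unfolding success_def mem_Collect_eq by metis
      have mm: "m \<in> messages K n RF \<times> messages K n RS" "m' \<in> messages K n RF \<times> messages K n RS"
        using W *(1,2) by auto
      have "fst m = fst m'"
        by (rule PiE_ext[of _ "{1..K}" "\<lambda>k. message_set n (RF k)"]) (use mm eq in \<open>auto simp: messages_def\<close>)
      moreover have "snd m = snd m'"
        by (rule PiE_ext[of _ "{1..K}" "\<lambda>k. message_set n (RS k)"]) (use mm eq in \<open>auto simp: messages_def\<close>)
      ultimately show "m = m'" by (rule prod_eqI)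
    qed
    show "(\<Sum>i\<in>IB. (x m i - x m' i)\<^sup>2) \<le> coarse_constant h K D * (\<Sum>i\<in>IA. (x m i - x m' i)\<^sup>2)"
      if *: "m \<in> W" "m' \<in> W" "z \<in> success H K n DT DR C m" "z' \<in> success H K n DT DR C m'"
      "\<And>i. i \<in> IA \<Longrightarrow> x m i + z i = x m' i + z' i" for m m' z z'
    proof -
      have "output_of H K n DT C m z k = output_of H K n DT C m' z' k" if "k \<in> observed K D" for k
        using *(5) by (rule out) (use that in \<open>auto simp: IA_def\<close>)
      then have ce: "inputs K DT C m k = inputs K DT C m' k" if "k \<in> centres K D" for k
        using centre[OF *(1-4)] that by blast
      define d where "d k t = signal H K DT C m k t - signal H K DT C m' k t" for k t
      \<comment> \<open>Time is moved outermost because coercivity holds separately in each time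
        slot.\<close>
      have sq: "(\<Sum>i\<in>A \<times> {1..n} \<times> UNIV. (x m i - x m' i)\<^sup>2) = (\<Sum>t=1..n. \<Sum>k\<in>A. (norm (d k t))\<^sup>2)" for A
      proof -
        have "(\<Sum>i\<in>A \<times> {1..n} \<times> UNIV. (x m i - x m' i)\<^sup>2) = (\<Sum>(k, t, i)\<in>A \<times> {1..n} \<times> UNIV. (d k t $ i)\<^sup>2)"
          by (intro sum.cong) (auto simp: x_def d_def)
        also have "\<dots> = (\<Sum>k\<in>A. \<Sum>t=1..n. (norm (d k t))\<^sup>2)" by (rule sum_square_components)
        also have "\<dots> = (\<Sum>t=1..n. \<Sum>k\<in>A. (norm (d k t))\<^sup>2)" by (rule sum.swap)
        finally show ?thesis .
      qed
      show ?thesis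
        unfolding IA_def IB_def sq sum_distrib_left[of "coarse_constant h K D" _ "{1..n}"] d_def
        by (intro sum_mono signal_coercive ce)
    qed
    show "(\<Sum>i\<in>IA. (x m i)\<^sup>2) \<le> 9 * h\<^sup>2 * real K * real n * P" if m: "m \<in> W" for m
    proof -
      have "(\<Sum>i\<in>IA. (x m i)\<^sup>2) = (\<Sum>(k, t, i)\<in>IA. (signal H K DT C m k t $ i)\<^sup>2)"
        by (intro sum.cong) (auto simp: x_def)
      also have "\<dots> = (\<Sum>k\<in>observed K D. \<Sum>t=1..n. (norm (signal H K DT C m k t))\<^sup>2)"
        unfolding IA_def by (rule sum_square_components)
      also have "\<dots> \<le> real (card (observed K D)) * (9 * h\<^sup>2 * real n * P)"
        using P n power[OF m] by (intro sum_bounded_above signal_energy) (auto simp: observed_def)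
      also have "card (observed K D) \<le> card {1..K}" by (intro card_mono) (auto simp: observed_def)
      then have "real (card (observed K D)) * (9 * h\<^sup>2 * real n * P) \<le> real K * (9 * h\<^sup>2 * real n * P)"
        using P by (intro mult_right_mono) auto
      finally show ?thesis by (simp add: mult_ac)
    qed
    show "0 < P" "1 \<le> coarse_constant h K D" by (rule P, rule cc)
  qed
  also have "\<dots> = packing_base h CARD('l) K D P ^ n"
  proof -
    have "card IA = CARD('l) * card (observed K D) * n" "card IB = CARD('l) * card (dropped K D) * n"
      by (simp_all add: IA_def IB_def card_cartesian_product mult_ac)
    moreover have "9 * h\<^sup>2 * real K * real n * P / (4 * P) = real n * (9 * h\<^sup>2 * real K / 4)"
      using P by simp
    ultimately show ?thesis
      by (simp only: packing_base_def power_mult_distrib power_mult exp_of_nat_mult)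
  qed
  finally show ?thesis unfolding I noise_space_def .
qed

text \<open>The input of a centre depends on slow messages up to \<open>DT\<close> users away, and
  each of these is decoded from outputs up to \<open>DR\<close> users further. By
  \<open>DT + DR \<le> D\<close> all of them are observed.\<close>

lemma sum_packing:
  fixes C :: "'l coding_scheme"
  assumes P: "0 < P" and n: "1 \<le> n" and R: "\<And>k. k \<in> {1..K} \<Longrightarrow> 0 \<le> RF k \<and> 0 \<le> RS k"
    and D: "DT + DR \<le> D" and adm: "admissible_scheme H K n P \<mu>T \<mu>R DT DR RF RS C"
  shows "(1 - error_prob H K n DT DR RF RS C) * (card (messages K n RF) * card (messages K n RS))
     \<le> packing_base h CARD('l) K D P ^ n"
proof -
  have meas: "measurable_receivers K n DR C" using adm by (simp add: admissible_scheme_def Let_def)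
  have "(\<Sum>m\<in>messages K n RF \<times> messages K n RS. measure (noise_space K n) (success H K n DT DR C m))
    \<le> packing_base h CARD('l) K D P ^ n"
  proof (rule network_packing[OF P n order.refl meas])
    fix m k assume "m \<in> messages K n RF \<times> messages K n RS" "k \<in> {1..K}"
    then show "(1 / real n) * (\<Sum>t=1..n. (norm (inputs K DT C m k t))\<^sup>2) \<le> P"
      using R adm by (intro power_constraint_everywhere[of K RF RS]) (auto simp: admissible_scheme_def Let_def)
  next
    fix m m' z z' k
    assume s: "z \<in> success H K n DT DR C m" "z' \<in> success H K n DT DR C m'"
      and o: "\<And>k. k \<in> observed K D \<Longrightarrow> output_of H K n DT C m z k = output_of H K n DT C m' z' k"
      and k: "k \<in> centres K D"
    have kK: "k \<in> {1..K}" by (rule centre_user[OF k])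
    show "inputs K DT C m k = inputs K DT C m' k"
    proof (rule inputs_eqI[OF kK])
      have "output_of H K n DT C m z k = output_of H K n DT C m' z' k"
        using kK by (intro o centre_block[OF k]) auto
      then show "fst m k = fst m' k" using s kK unfolding success_def mem_Collect_eq by metis
      fix k' assume k': "k' \<in> {1..K}" "k' \<le> k + DT" "k \<le> k' + DT"
      have "received K DR (exchange K (rx_msg C) (output_of H K n DT C m z) DR) k' =
          received K DR (exchange K (rx_msg C) (output_of H K n DT C m' z') DR) k'"
        using k'(1) by (rule exchange_local) (use k' D in \<open>auto intro!: o centre_block[OF k]\<close>)
      moreover have "output_of H K n DT C m z k' = output_of H K n DT C m' z' k'"
        using k' D by (intro o centre_block[OF k]) auto
      ultimately show "snd m k' = snd m' k'" using s k'(1) unfolding success_def mem_Collect_eq by metis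
    qed
  qed
  then show ?thesis using R meas by (subst (asm) sum_success) auto
qed

lemma fast_packing:
  fixes C :: "'l coding_scheme"
  assumes P: "0 < P" and n: "1 \<le> n" and R: "\<And>k. k \<in> {1..K} \<Longrightarrow> 0 \<le> RF k \<and> 0 \<le> RS k"
    and adm: "admissible_scheme H K n P \<mu>T \<mu>R DT DR RF RS C"
  shows "(1 - error_prob H K n DT DR RF RS C) * card (messages K n RF) \<le> packing_base h CARD('l) K 0 P ^ n"
proof -
  have meas: "measurable_receivers K n DR C" using adm by (simp add: admissible_scheme_def Let_def)
  define b where "b = packing_base h CARD('l) K 0 P ^ n"
  define cS where "cS = card (messages K n RS)"
  have cS: "cS > 0" unfolding cS_def using R by (intro card_messages_pos) auto
  have slice: "(\<Sum>mF\<in>messages K n RF. measure (noise_space K n) (success H K n DT DR C (mF, mS))) \<le> b"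
    if mS: "mS \<in> messages K n RS" for mS
  proof -
    have "(\<Sum>m\<in>messages K n RF \<times> {mS}. measure (noise_space K n) (success H K n DT DR C m)) \<le> b"
      unfolding b_def
    proof (rule network_packing[OF P n _ meas])
      show "messages K n RF \<times> {mS} \<subseteq> messages K n RF \<times> messages K n RS" using mS by auto
    next
      fix m k assume "m \<in> messages K n RF \<times> {mS}" "k \<in> {1..K}"
      then show "(1 / real n) * (\<Sum>t=1..n. (norm (inputs K DT C m k t))\<^sup>2) \<le> P"
        using R adm mS by (intro power_constraint_everywhere[of K RF RS]) (auto simp: admissible_scheme_def Let_def)
    next
      fix m m' z z' k
      assume m: "m \<in> messages K n RF \<times> {mS}" "m' \<in> messages K n RF \<times> {mS}"
        and s: "z \<in> success H K n DT DR C m" "z' \<in> success H K n DT DR C m'"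
        and o: "\<And>k. k \<in> observed K 0 \<Longrightarrow> output_of H K n DT C m z k = output_of H K n DT C m' z' k"
        and k: "k \<in> centres K 0"
      have kK: "k \<in> {1..K}" by (rule centre_user[OF k])
      show "inputs K DT C m k = inputs K DT C m' k"
      proof (rule inputs_eqI[OF kK])
        have "output_of H K n DT C m z k = output_of H K n DT C m' z' k"
          using kK by (intro o centre_block[OF k]) auto
        then show "fst m k = fst m' k" using s kK unfolding success_def mem_Collect_eq by metis
      qed (use m in auto)
    qed
    moreover have "messages K n RF \<times> {mS} = (\<lambda>mF. (mF, mS)) ` messages K n RF" by auto
    ultimately show ?thesis by (simp add: sum.reindex inj_on_def)
  qed
  have "(1 - error_prob H K n DT DR RF RS C) * (card (messages K n RF) * cS) =
     (\<Sum>m\<in>messages K n RF \<times> messages K n RS. measure (noise_space K n) (success H K n DT DR C m))"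
    using R meas unfolding cS_def by (subst sum_success) auto
  also have "\<dots> = (\<Sum>mS\<in>messages K n RS. \<Sum>mF\<in>messages K n RF. measure (noise_space K n) (success H K n DT DR C (mF, mS)))"
    by (subst sum.swap) (simp add: sum.cartesian_product)
  also have "\<dots> \<le> real cS * b" unfolding cS_def by (intro sum_bounded_above slice)
  finally show ?thesis using cS by (simp add: b_def mult.commute mult.left_commute)
qed

end

section \<open>Multiplexing gains\<close>

text \<open>Rounding down at most halves a number that is at least 1; \<open>K\<close> users lose a
  factor \<open>2 ^ K\<close>, which is constant in \<open>n\<close>.\<close>

lemma card_messages_ge:
  assumes "\<And>k. k \<in> {1..K} \<Longrightarrow> 0 \<le> R k"
  shows "1 / 2 ^ K * 2 powr (real n * (\<Sum>k=1..K. R k)) \<le> real (card (messages K n R))"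
proof -
  have half: "x / 2 \<le> of_int \<lfloor>x\<rfloor>" if "x \<ge> 1" for x :: real
  proof -
    have "(1::real) \<le> of_int \<lfloor>x\<rfloor>" using that by simp
    moreover have "x < of_int \<lfloor>x\<rfloor> + 1" by linarith
    ultimately show ?thesis by linarith
  qed
  have "1 / 2 ^ K * 2 powr (real n * (\<Sum>k=1..K. R k)) = (\<Prod>k=1..K. 2 powr (real n * R k) / 2)"
    by (simp add: sum_distrib_left powr_sum prod_dividef)
  also have "\<dots> \<le> (\<Prod>k=1..K. real (card (message_set n (R k))))"
    using assms half by (intro prod_mono) (simp add: card_message_set ge_one_powr_ge_zero)
  finally show ?thesis by (simp add: card_messages)
qed

text \<open>Otherwise \<open>(2 powr r / b) ^ n\<close> would grow without bound, although it is at
  most \<open>2 / c\<close> as soon as the error is below 1/2.\<close>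

lemma exponential_rate_le:
  fixes b c r :: real
  assumes \<epsilon>: "\<epsilon> \<longlonglongrightarrow> 0" and "c > 0" "b > 0"
    and le: "\<And>n. n \<ge> 1 \<Longrightarrow> (1 - \<epsilon> n) * (c * 2 powr (real n * r)) \<le> b ^ n"
  shows "r \<le> log 2 b"
proof (rule ccontr)
  assume "\<not> r \<le> log 2 b"
  then have "b < 2 powr r" using \<open>b > 0\<close> by (simp add: log_less_iff not_le)
  define q where "q = 2 powr r / b"
  have q: "q > 1" using \<open>b < 2 powr r\<close> \<open>b > 0\<close> by (simp add: q_def)
  have "\<forall>\<^sub>F n in sequentially. inverse (q ^ n) < c / 2"
    using LIMSEQ_inverse_realpow_zero[OF q] \<open>c > 0\<close> by (intro order_tendstoD) auto
  moreover have "\<forall>\<^sub>F n in sequentially. \<epsilon> n < 1 / 2"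
    using \<epsilon> by (intro order_tendstoD) auto
  ultimately have "\<forall>\<^sub>F n in sequentially. inverse (q ^ n) < c / 2 \<and> \<epsilon> n < 1 / 2 \<and> n \<ge> 1"
    by (intro eventually_conj eventually_ge_at_top)
  then obtain n where n: "inverse (q ^ n) < c / 2" "\<epsilon> n < 1 / 2" "n \<ge> 1"
    using eventually_happens'[OF sequentially_bot] by blast
  have "2 powr (real n * r) = (2 powr r) ^ n" by (simp add: powr_realpow[symmetric] powr_powr mult.commute)
  also have "\<dots> = q ^ n * b ^ n" using \<open>b > 0\<close> by (simp add: q_def power_divide)
  finally have "((1 - \<epsilon> n) * c * q ^ n) * b ^ n \<le> 1 * b ^ n" using le[OF n(3)] by (simp add: mult_ac)
  then have "(1 - \<epsilon> n) * c * q ^ n \<le> 1" using \<open>b > 0\<close> by (simp only: mult_le_cancel_right_pos zero_less_power)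
  moreover have "1 / 2 * c * q ^ n \<le> (1 - \<epsilon> n) * c * q ^ n"
    using n(2) \<open>c > 0\<close> q by (intro mult_right_mono) auto
  ultimately have "c / 2 * q ^ n \<le> 1" by simp
  then have "c / 2 \<le> inverse (q ^ n)" using q by (simp add: field_simps)
  then show False using n(1) by simp
qed

lemma packing_base_pos: "P > 0 \<Longrightarrow> packing_base h L K D P > 0"
  unfolding packing_base_def coarse_constant_def
  by (intro mult_pos_pos zero_less_power) (auto intro!: add_pos_nonneg)

text \<open>The part of the logarithm that is constant in \<open>P\<close>. Its last summand covers
  the gap between \<open>sqrt (2 * (1 + P))\<close> and \<open>sqrt P\<close>, as
  \<open>2 * (1 + P)\<close> is at most \<open>4 * P\<close> for \<open>P \<ge> 1\<close>.\<close>

definition packing_offset :: "real \<Rightarrow> nat \<Rightarrow> nat \<Rightarrow> nat \<Rightarrow> real" where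
  "packing_offset h L K D =
     log 2 (sqrt (16 * coarse_constant h K D) ^ (L * card (dropped K D)) * exp (9 * h\<^sup>2 * real K / 4))
     + real (L * card (observed K D))"

lemma log_packing_base_le:
  assumes "P \<ge> 1"
  shows "log 2 (packing_base h L K D P) \<le>
    real (L * card (observed K D)) * (1 / 2 * log 2 P) + packing_offset h L K D"
proof -
  define N where "N = L * card (observed K D)"
  define Y where "Y = sqrt (16 * coarse_constant h K D) ^ (L * card (dropped K D)) * exp (9 * h\<^sup>2 * real K / 4)"
  have pos: "0 < Y"
    unfolding Y_def coarse_constant_def by (intro mult_pos_pos zero_less_power) (auto intro!: add_pos_nonneg)
  have sq: "log 2 (sqrt (2 * (1 + P))) = log 2 (2 * (1 + P)) / 2"
    using assms by (simp add: log_def ln_sqrt)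
  have "log 2 (2 * (1 + P)) \<le> log 2 (2 ^ 2 * P)" using assms by (intro log_mono) auto
  also have "\<dots> = 2 + log 2 P" using assms by (subst log_mult) (use log_pow_cancel[of 2 2] in auto)
  finally have le: "log 2 (sqrt (2 * (1 + P))) \<le> 1 + 1 / 2 * log 2 P" using sq by simp
  have "log 2 (packing_base h L K D P) = real N * log 2 (sqrt (2 * (1 + P))) + (packing_offset h L K D - real N)"
    unfolding packing_base_def packing_offset_def mult.assoc[of "_ ^ _"] Y_def[symmetric] N_def[symmetric]
    using assms pos by (subst log_mult) (auto simp: log_nat_power)
  also have "\<dots> \<le> real N * (1 + 1 / 2 * log 2 P) + (packing_offset h L K D - real N)"
    using le by (intro add_right_mono mult_left_mono) auto
  finally show ?thesis by (simp add: N_def algebra_simps)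
qed

section \<open>Rate bounds for fixed K and P, then the limits in P and K\<close>

context wyner_network
begin

lemma rates_le:
  assumes P: "P > 0" and K: "K > 0" and ach: "average_rates_achievable H K P \<mu>T \<mu>R D rF rS"
  shows "0 \<le> rF" "0 \<le> rS"
    and "real K * rF \<le> log 2 (packing_base h CARD('l) K 0 P)"
    and "real K * (rF + rS) \<le> log 2 (packing_base h CARD('l) K D P)"
proof -
  obtain RF RS DT DR and C :: "nat \<Rightarrow> 'l coding_scheme" where
    R: "\<And>k. k \<in> {1..K} \<Longrightarrow> 0 \<le> RF k \<and> 0 \<le> RS k"
    and rF: "rF = (1 / real K) * (\<Sum>k=1..K. RF k)" and rS: "rS = (1 / real K) * (\<Sum>k=1..K. RS k)"
    and D: "DT + DR \<le> D"
    and adm: "\<And>n. n \<ge> 1 \<Longrightarrow> admissible_scheme H K n P \<mu>T \<mu>R DT DR RF RS (C n)"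
    and err: "(\<lambda>n. error_prob H K n DT DR RF RS (C n)) \<longlonglongrightarrow> 0"
    using ach unfolding average_rates_achievable_def by blast
  have KF: "real K * rF = (\<Sum>k=1..K. RF k)" and KS: "real K * rS = (\<Sum>k=1..K. RS k)"
    using K by (simp_all add: rF rS)
  show "0 \<le> rF" "0 \<le> rS" using R by (auto simp: rF rS intro!: divide_nonneg_nonneg sum_nonneg)
  let ?e = "\<lambda>n. error_prob H K n DT DR RF RS (C n)"
  have e1: "?e n \<le> 1" for n
  proof -
    interpret M: prob_space "sample_space K n RF RS :: 'l sample measure"
      using R by (intro prob_space_sample_space) auto
    show ?thesis unfolding error_prob_def Let_def by (rule M.prob_le_1)
  qed
  have cF: "1 / 2 ^ K * 2 powr (real n * (real K * rF)) \<le> real (card (messages K n RF))" for n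
    unfolding KF using R by (intro card_messages_ge) auto
  have cS: "1 / 2 ^ K * 2 powr (real n * (real K * rS)) \<le> real (card (messages K n RS))" for n
    unfolding KS using R by (intro card_messages_ge) auto
  show "real K * rF \<le> log 2 (packing_base h CARD('l) K 0 P)"
  proof (rule exponential_rate_le[OF err])
    fix n :: nat assume n: "n \<ge> 1"
    have "(1 - ?e n) * (1 / 2 ^ K * 2 powr (real n * (real K * rF))) \<le> (1 - ?e n) * card (messages K n RF)"
      using e1[of n] cF by (intro mult_left_mono) auto
    also have "\<dots> \<le> packing_base h CARD('l) K 0 P ^ n"
      using fast_packing[OF P n R adm[OF n]] .
    finally show "(1 - ?e n) * (1 / 2 ^ K * 2 powr (real n * (real K * rF))) \<le> packing_base h CARD('l) K 0 P ^ n" .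
  qed (use packing_base_pos[OF P] in auto)
  show "real K * (rF + rS) \<le> log 2 (packing_base h CARD('l) K D P)"
  proof (rule exponential_rate_le[OF err])
    fix n :: nat assume n: "n \<ge> 1"
    have "1 / 2 ^ K * (1 / 2 ^ K) * 2 powr (real n * (real K * (rF + rS))) =
        (1 / 2 ^ K * 2 powr (real n * (real K * rF))) * (1 / 2 ^ K * 2 powr (real n * (real K * rS)))"
      by (simp add: powr_add distrib_left)
    also have "\<dots> \<le> real (card (messages K n RF)) * real (card (messages K n RS))"
      by (intro mult_mono cF cS) auto
    finally have "(1 - ?e n) * (1 / 2 ^ K * (1 / 2 ^ K) * 2 powr (real n * (real K * (rF + rS))))
       \<le> (1 - ?e n) * (real (card (messages K n RF)) * real (card (messages K n RS)))"
      using e1[of n] by (intro mult_left_mono) auto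
    also have "\<dots> \<le> packing_base h CARD('l) K D P ^ n"
      using sum_packing[OF P n R D adm[OF n]] by simp
    finally show "(1 - ?e n) * (1 / 2 ^ K * (1 / 2 ^ K) * 2 powr (real n * (real K * (rF + rS))))
       \<le> packing_base h CARD('l) K D P ^ n" .
  qed (use packing_base_pos[OF P] in auto)
qed

end

text \<open>Along the common sequence the sum converges to \<open>a + b\<close>, so a bound on the
  sum passes to the limit. Nonnegativity excludes opposite infinities in the extended reals; it is
  also a conclusion, because the limit in \<open>K\<close> needs it again for the gains obtained
  from the limit in \<open>P\<close>.\<close>

lemma joint_limsup_le:
  assumes lim: "joint_limsup F f g a b" and F: "F \<noteq> bot"
    and nn: "\<forall>\<^sub>F x in F. 0 \<le> f x" "\<forall>\<^sub>F x in F. 0 \<le> g x"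
  shows "0 \<le> a" "0 \<le> b"
    and "\<forall>\<^sub>F x in F. f x \<le> u x \<Longrightarrow> (u \<longlongrightarrow> c) F \<Longrightarrow> a \<le> c"
    and "\<forall>\<^sub>F x in F. f x + g x \<le> u x \<Longrightarrow> (u \<longlongrightarrow> c) F \<Longrightarrow> a + b \<le> c"
proof -
  obtain s where s: "filterlim s F sequentially" "(\<lambda>i. f (s i)) \<longlonglongrightarrow> a" "(\<lambda>i. g (s i)) \<longlonglongrightarrow> b"
    using lim by (auto simp: joint_limsup_def)
  have ev: "\<forall>\<^sub>F i in sequentially. Q (s i)" if "\<forall>\<^sub>F x in F. Q x" for Q
    using that s(1) by (rule eventually_compose_filterlim)
  show a: "0 \<le> a" using ev[OF nn(1)] by (intro tendsto_lowerbound[OF s(2)]) auto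
  show b: "0 \<le> b" using ev[OF nn(2)] by (intro tendsto_lowerbound[OF s(3)]) auto
  show "a \<le> c" if "\<forall>\<^sub>F x in F. f x \<le> u x" "(u \<longlongrightarrow> c) F"
    using ev[OF that(1)] by (intro tendsto_le[OF _ filterlim_compose[OF that(2) s(1)] s(2)]) auto
  have "(\<lambda>i. f (s i) + g (s i)) \<longlonglongrightarrow> a + b" using a b s by (intro tendsto_add_ereal_nonneg) auto
  then show "a + b \<le> c" if "\<forall>\<^sub>F x in F. f x + g x \<le> u x" "(u \<longlongrightarrow> c) F"
    using ev[OF that(1)] by (intro tendsto_le[OF _ filterlim_compose[OF that(2) s(1)]]) auto
qed

lemma normalised_bound_tendsto:
  "((\<lambda>P. ereal ((N * (1 / 2 * log 2 P) + c) / (1 / 2 * log 2 P))) \<longlongrightarrow> ereal N) at_top"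
proof -
  have "filterlim (\<lambda>P::real. log 2 P) at_top at_top"
    unfolding log_def by (intro filterlim_tendsto_pos_mult_at_top[OF tendsto_const, of "1 / ln 2", simplified]) (auto intro: ln_at_top)
  then have "((\<lambda>P. 2 * c / log 2 P) \<longlongrightarrow> 0) at_top"
    by (intro tendsto_divide_0[OF tendsto_const] filterlim_at_top_imp_at_infinity)
  then have "((\<lambda>P. N + 2 * c / log 2 P) \<longlongrightarrow> N + 0) at_top" by (intro tendsto_add tendsto_const)
  moreover have "\<forall>\<^sub>F P in at_top. N + 2 * c / log 2 P = (N * (1 / 2 * log 2 P) + c) / (1 / 2 * log 2 P)"
    using eventually_gt_at_top[of 1]
  proof eventually_elim
    case (elim P)
    then have "log 2 P > 0" by simp
    then show ?case by (simp add: field_simps)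
  qed
  ultimately have "((\<lambda>P. (N * (1 / 2 * log 2 P) + c) / (1 / 2 * log 2 P)) \<longlongrightarrow> N) at_top"
    by (simp add: tendsto_cong)
  then show ?thesis by simp
qed

text \<open>\<open>K\<close> is fixed while \<open>P\<close> tends to infinity, so \<open>h\<close>
  and the offset are constants and only the fraction of observed receivers survives. The pattern
  with reach 0 gives the fast bound, the one with reach \<open>D\<close> the bound on the
  sum.\<close>

lemma per_network_gain_le:
  fixes H :: "nat \<Rightarrow> nat \<Rightarrow> real ^ ('l::finite) ^ 'l"
  assumes full_rank:
      "\<And>k' k. k \<ge> 1 \<Longrightarrow> k' \<ge> 1 \<Longrightarrow> k' \<in> {k - 1, k, k + 1} \<Longrightarrow> rank (H k' k) = CARD('l)"
    and K: "K > 0"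
    and ach: "\<And>P. P > 0 \<Longrightarrow> average_rates_achievable H K P \<mu>T \<mu>R D (rF P) (rS P)"
    and lim: "joint_limsup at_top (\<lambda>P. ereal (rF P / (1 / 2 * log 2 P)))
       (\<lambda>P. ereal (rS P / (1 / 2 * log 2 P))) gF gS"
  shows "0 \<le> gF" "0 \<le> gS"
    and "gF \<le> ereal (real CARD('l) * (1 / 2 + 4 / real K))"
    and "gF + gS \<le> ereal (real CARD('l) * ((real D + 1) / (real D + 2) + 4 / real K))"
proof -
  obtain h where "h \<ge> 1"
    "\<And>k k' v. \<lbrakk>k \<in> {1..K}; k' \<in> {k - 1, k, k + 1}\<rbrakk> \<Longrightarrow> norm (H k' k *v v) \<le> h * norm v"
    "\<And>k k' v. \<lbrakk>k \<in> {1..K}; k' \<in> {k - 1, k, k + 1}; k' \<ge> 1\<rbrakk> \<Longrightarrow> norm v \<le> h * norm (H k' k *v v)"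
    using channel_bounds[where H = H and K = K, OF full_rank] by blast
  then interpret wyner_network H K h by unfold_locales
  have rate: "r / (1 / 2 * log 2 P) \<le>
      (real (CARD('l) * card (observed K D')) / real K * (1 / 2 * log 2 P) + packing_offset h CARD('l) K D' / real K) / (1 / 2 * log 2 P)"
    if "real K * r \<le> log 2 (packing_base h CARD('l) K D' P)" "P > 1" for D' r P
  proof -
    have "real K * r \<le> real (CARD('l) * card (observed K D')) * (1 / 2 * log 2 P) + packing_offset h CARD('l) K D'"
      using that(1) log_packing_base_le[of P h "CARD('l)" K D'] that(2) by linarith
    then have "r \<le> (real (CARD('l) * card (observed K D')) * (1 / 2 * log 2 P) + packing_offset h CARD('l) K D') / real K"
      using K by (simp add: pos_le_divide_eq mult.commute)
    moreover have "0 < 1 / 2 * log 2 P" using that(2) by simp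
    ultimately show ?thesis by (intro divide_right_mono) (auto simp: add_divide_distrib)
  qed
  have gt1: "\<forall>\<^sub>F P::real in at_top. P > 1" by (rule eventually_gt_at_top)
  have nnF: "\<forall>\<^sub>F P in at_top. 0 \<le> ereal (rF P / (1 / 2 * log 2 P))"
    using gt1 by eventually_elim (use rates_le(1)[OF _ K ach] in \<open>auto intro!: divide_nonneg_pos\<close>)
  have nnS: "\<forall>\<^sub>F P in at_top. 0 \<le> ereal (rS P / (1 / 2 * log 2 P))"
    using gt1 by eventually_elim (use rates_le(2)[OF _ K ach] in \<open>auto intro!: divide_nonneg_pos\<close>)
  note jl = joint_limsup_le[OF lim _ nnF nnS]
  show "0 \<le> gF" "0 \<le> gS" using jl(1,2) by simp_all
  have obs: "ereal (real (CARD('l) * card (observed K D')) / real K) \<le>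
      ereal (real CARD('l) * ((real D' + 1) / (real D' + 2) + 4 / real K))" for D'
  proof -
    have "real (card (observed K D')) / real K \<le> (real K * ((real D' + 1) / (real D' + 2)) + 4) / real K"
      by (intro divide_right_mono card_observed_le) auto
    also have "\<dots> = (real D' + 1) / (real D' + 2) + 4 / real K"
      using K by (simp add: add_divide_distrib)
    finally have "real CARD('l) * (real (card (observed K D')) / real K) \<le>
       real CARD('l) * ((real D' + 1) / (real D' + 2) + 4 / real K)" by (intro mult_left_mono) auto
    then show ?thesis by simp
  qed
  have "gF \<le> ereal (real (CARD('l) * card (observed K 0)) / real K)"
  proof (rule jl(3)[OF _ _ normalised_bound_tendsto])
    show "\<forall>\<^sub>F P in at_top. ereal (rF P / (1 / 2 * log 2 P)) \<le> ereal
      ((real (CARD('l) * card (observed K 0)) / real K * (1 / 2 * log 2 P) + packing_offset h CARD('l) K 0 / real K) / (1 / 2 * log 2 P))"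
      using gt1
    proof eventually_elim
      case (elim P)
      then show ?case unfolding ereal_less_eq by (intro rate rates_le(3)[OF _ K ach]) auto
    qed
  qed simp
  also note obs[of 0]
  finally show "gF \<le> ereal (real CARD('l) * (1 / 2 + 4 / real K))" by simp
  have "gF + gS \<le> ereal (real (CARD('l) * card (observed K D)) / real K)"
  proof (rule jl(4)[OF _ _ normalised_bound_tendsto])
    show "\<forall>\<^sub>F P in at_top. ereal (rF P / (1 / 2 * log 2 P)) + ereal (rS P / (1 / 2 * log 2 P)) \<le> ereal
      ((real (CARD('l) * card (observed K D)) / real K * (1 / 2 * log 2 P) + packing_offset h CARD('l) K D / real K) / (1 / 2 * log 2 P))"
      using gt1
    proof eventually_elim
      case (elim P)
      then show ?case unfolding plus_ereal.simps ereal_less_eq add_divide_distrib[of "rF P" "rS P", symmetric]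
        by (intro rate rates_le(4)[OF _ K ach]) auto
    qed
  qed simp
  also note obs[of D]
  finally show "gF + gS \<le> ereal (real CARD('l) * ((real D + 1) / (real D + 2) + 4 / real K))" .
qed

lemma achievable_mg_bounds:
  fixes H :: "nat \<Rightarrow> nat \<Rightarrow> real ^ ('l::finite) ^ 'l"
  assumes full_rank:
      "\<And>k' k. k \<ge> 1 \<Longrightarrow> k' \<ge> 1 \<Longrightarrow> k' \<in> {k - 1, k, k + 1} \<Longrightarrow> rank (H k' k) = CARD('l)"
    and mem: "(SF, SS) \<in> achievable_mg_pairs H \<mu>T \<mu>R D"
  shows "SF \<le> real CARD('l) / 2 \<and> SF + SS \<le> real CARD('l) * ((real D + 1) / (real D + 2))"
proof -
  obtain rF rS :: "nat \<Rightarrow> real \<Rightarrow> real" and gF gS where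
    ach: "\<And>K P. 0 < K \<and> even K \<and> 0 < P \<Longrightarrow> average_rates_achievable H K P \<mu>T \<mu>R D (rF K P) (rS K P)"
    and lim: "\<And>K. 0 < K \<and> even K \<Longrightarrow> joint_limsup at_top
             (\<lambda>P. ereal (rF K P / (1 / 2 * log 2 P))) (\<lambda>P. ereal (rS K P / (1 / 2 * log 2 P))) (gF K) (gS K)"
    and LIM: "joint_limsup sequentially (\<lambda>m. gF (2 * m)) (\<lambda>m. gS (2 * m)) (ereal SF) (ereal SS)"
    using mem unfolding achievable_mg_pairs_def by blast
  note gain = per_network_gain_le[OF full_rank _ ach lim]
  have pos: "\<forall>\<^sub>F m::nat in sequentially. m > 0" by (rule eventually_gt_at_top)
  have nnF: "\<forall>\<^sub>F m in sequentially. 0 \<le> gF (2 * m)"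
    using pos by eventually_elim (auto intro: gain(1))
  have nnS: "\<forall>\<^sub>F m in sequentially. 0 \<le> gS (2 * m)"
    using pos by eventually_elim (auto intro: gain(2))
  have u: "(\<lambda>m. ereal (real CARD('l) * (x + 4 / real (2 * m)))) \<longlonglongrightarrow> ereal (real CARD('l) * x)" for x
  proof -
    have "(\<lambda>m. 2 / real m) \<longlonglongrightarrow> 0" by (rule lim_const_over_n)
    then have "(\<lambda>m. real CARD('l) * (x + 2 / real m)) \<longlonglongrightarrow> real CARD('l) * (x + 0)"
      by (intro tendsto_intros)
    then show ?thesis by simp
  qed
  note jl = joint_limsup_le[OF LIM _ nnF nnS]
  have "ereal SF \<le> ereal (real CARD('l) * (1 / 2))"
  proof (rule jl(3)[OF _ _ u])
    show "\<forall>\<^sub>F m in sequentially. gF (2 * m) \<le> ereal (real CARD('l) * (1 / 2 + 4 / real (2 * m)))"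
      using pos by eventually_elim (rule gain(3); simp)
  qed simp
  moreover have "ereal SF + ereal SS \<le> ereal (real CARD('l) * ((real D + 1) / (real D + 2)))"
  proof (rule jl(4)[OF _ _ u])
    show "\<forall>\<^sub>F m in sequentially. gF (2 * m) + gS (2 * m) \<le>
        ereal (real CARD('l) * ((real D + 1) / (real D + 2) + 4 / real (2 * m)))"
      using pos by eventually_elim (rule gain(4); simp)
  qed simp
  ultimately show ?thesis by simp
qed

theorem proposition1:
  fixes H :: "nat \<Rightarrow> nat \<Rightarrow> real ^ ('l::finite) ^ 'l"
    and \<mu>T \<mu>R :: real and D :: nat and SF SS :: real
  assumes full_rank:
      "\<And>k' k. k \<ge> 1 \<Longrightarrow> k' \<ge> 1 \<Longrightarrow> k' \<in> {k - 1, k, k + 1} \<Longrightarrow> rank (H k' k) = CARD('l)"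
    and "\<mu>T \<ge> 0" and "\<mu>R \<ge> 0" and "even D"
    and "(SF, SS) \<in> optimal_mg_region H \<mu>T \<mu>R D"
  shows "SF \<le> real CARD('l) / 2 \<and>
         SF + SS \<le> real CARD('l) * ((real D + 1) / (real D + 2))"
proof -
  define B where "B = {x :: real \<times> real. fst x \<le> real CARD('l) / 2} \<inter>
      {x. fst x + snd x \<le> real CARD('l) * ((real D + 1) / (real D + 2))}"
  have "closed B"
    unfolding B_def by (intro closed_Int closed_Collect_le continuous_intros)
  moreover have "achievable_mg_pairs H \<mu>T \<mu>R D \<subseteq> B"
    using achievable_mg_bounds[OF full_rank] by (auto simp: B_def)
  ultimately have "optimal_mg_region H \<mu>T \<mu>R D \<subseteq> B"
    unfolding optimal_mg_region_def by (rule closure_minimal[rotated])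
  then show ?thesis using assms(5) by (auto simp: B_def)
qed

end
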